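(* Let $(M,\langle\cdot,\cdot\rangle)$ be a Riemannian 3-manifold without boundary, let $U\subseteq M$ be open, and let $k$ be a smooth unit vector field on $U$. If $k$ is 2-principal, i.e. $R(k,\cdot,\cdot,\cdot)=0$ on $U$, then the scalar curvature $S$ satisfies on $U$ $$k[S]=-(\mathrm{div}\,k)\,S.$$ Moreover, if $S$ is nonzero at a point $p\in U$, then the integral curve of $k$ through $p$ is a geodesic.
   Context: $\nabla$ is the Levi-Civita connection, and the Riemann 4-tensor is $R(u,v,w,z)=\langle\nabla_u\nabla_v w-\nabla_v\nabla_u w-\nabla_{[u,v]}w,\,z\rangle$. The Ricci tensor is the trace of $R$ on its first and last indices: $\mathrm{Ric}(v,w)=\sum_i R(e_i,v,w,e_i)$ for an orthonormal frame $\{e_i\}$; $S$ is the trace of $\mathrm{Ric}$. For a non-flat Riemannian 3-manifold $M$, a smooth unit vector field $k$ on an open subset of $M$ is called 2-principal if $R(k,\cdot,\cdot,\cdot)=0$. The notation $k[S]$ means the derivative of the function $S$ in the direction $k$, and $\mathrm{div}\,k$ is the trace of $v\mapsto\nabla_v k$. *)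

theory Defs
  imports "HOL-Analysis.Analysis"
begin

primrec times_differentiable_on ::
  "nat \<Rightarrow> 'b::real_normed_vector set \<Rightarrow> ('b \<Rightarrow> 'c::real_normed_vector) \<Rightarrow> bool" where
  "times_differentiable_on 0 S f \<longleftrightarrow> continuous_on S f"
| "times_differentiable_on (Suc n) S f \<longleftrightarrow>
     (\<forall>x\<in>S. f differentiable (at x)) \<and>
     (\<forall>v. times_differentiable_on n S (\<lambda>x. frechet_derivative f (at x) v))"

text \<open>Used only for open \<open>S\<close>.\<close>

definition smooth_on ::
  "'b::real_normed_vector set \<Rightarrow> ('b \<Rightarrow> 'c::real_normed_vector) \<Rightarrow> bool" where
  "smooth_on S f \<longleftrightarrow> (\<forall>n. times_differentiable_on n S f)"

text \<open>The underlying set of the manifold is the whole type \<open>'a\<close>. A chart is a pair of an open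
  domain and a coordinate map, only the values of which on the domain matter; the dimension is
  \<open>CARD('n)\<close>. All charts take values in open subsets of \<open>real ^ 'n\<close>, so there is no boundary.\<close>

type_synonym ('a, 'n) chart = "'a set \<times> ('a \<Rightarrow> real ^ 'n)"

locale smooth_manifold =
  fixes A :: "('a::{t2_space, second_countable_topology}, 'n::finite) chart set"
  assumes open_domain: "(C, \<phi>) \<in> A \<Longrightarrow> open C"
    and open_range: "(C, \<phi>) \<in> A \<Longrightarrow> open (\<phi> ` C)"
    and chart_homeomorphism: "(C, \<phi>) \<in> A \<Longrightarrow> homeomorphism C (\<phi> ` C) \<phi> (inv_into C \<phi>)"
    and covering: "(\<Union>(C, \<phi>)\<in>A. C) = UNIV"
    and smooth_transition:
      "(C, \<phi>) \<in> A \<Longrightarrow> (C', \<psi>) \<in> A \<Longrightarrow> smooth_on (\<phi> ` (C \<inter> C')) (\<psi> \<circ> inv_into C \<phi>)"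

definition smooth_fun ::
  "('a::topological_space, 'n::finite) chart set \<Rightarrow> 'a set \<Rightarrow> ('a \<Rightarrow> real) \<Rightarrow> bool" where
  "smooth_fun A V f \<longleftrightarrow> (\<forall>(C, \<phi>)\<in>A. smooth_on (\<phi> ` (C \<inter> V)) (f \<circ> inv_into C \<phi>))"

definition smooth_near ::
  "('a::topological_space, 'n::finite) chart set \<Rightarrow> 'a \<Rightarrow> ('a \<Rightarrow> real) \<Rightarrow> bool" where
  "smooth_near A p f \<longleftrightarrow> (\<exists>V. open V \<and> p \<in> V \<and> smooth_fun A V f)"

definition smooth_curve ::
  "('a::topological_space, 'n::finite) chart set \<Rightarrow> real set \<Rightarrow> (real \<Rightarrow> 'a) \<Rightarrow> bool" where
  "smooth_curve A I \<gamma> \<longleftrightarrow>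
     continuous_on I \<gamma> \<and> (\<forall>(C, \<phi>)\<in>A. smooth_on {t\<in>I. \<gamma> t \<in> C} (\<phi> \<circ> \<gamma>))"

text \<open>A tangent vector at \<open>p\<close> is identified with its action on functions that are smooth near \<open>p\<close>.
  It is set to \<open>0\<close> on all other functions, so that equality of tangent vectors is equality of
  functionals and the zero vector is \<open>\<lambda>f. 0\<close>. Vector operations are written out pointwise.\<close>

type_synonym 'a tangent = "('a \<Rightarrow> real) \<Rightarrow> real"
type_synonym 'a vfield = "'a \<Rightarrow> 'a tangent"

definition velocity ::
  "('a::topological_space, 'n::finite) chart set \<Rightarrow> (real \<Rightarrow> 'a) \<Rightarrow> real \<Rightarrow> 'a tangent" where
  "velocity A \<gamma> t = (\<lambda>f. if smooth_near A (\<gamma> t) f then deriv (f \<circ> \<gamma>) t else 0)"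

definition tangent_space ::
  "('a::topological_space, 'n::finite) chart set \<Rightarrow> 'a \<Rightarrow> 'a tangent set" where
  "tangent_space A p =
     {velocity A \<gamma> 0 | \<gamma>. \<gamma> 0 = p \<and> (\<exists>\<epsilon>>0. smooth_curve A {-\<epsilon><..<\<epsilon>} \<gamma>)}"

text \<open>Fields are total functions; only their values on the open set \<open>V\<close> matter.\<close>

definition smooth_vfield ::
  "('a::topological_space, 'n::finite) chart set \<Rightarrow> 'a set \<Rightarrow> 'a vfield \<Rightarrow> bool" where
  "smooth_vfield A V X \<longleftrightarrow>
     (\<forall>p\<in>V. X p \<in> tangent_space A p) \<and>
     (\<forall>W f. open W \<and> W \<subseteq> V \<and> smooth_fun A W f \<longrightarrow> smooth_fun A W (\<lambda>p. X p f))"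

definition lie_bracket ::
  "('a::topological_space, 'n::finite) chart set \<Rightarrow> 'a vfield \<Rightarrow> 'a vfield \<Rightarrow> 'a vfield" where
  "lie_bracket A X Y =
     (\<lambda>p f. if smooth_near A p f then X p (\<lambda>q. Y q f) - Y p (\<lambda>q. X q f) else 0)"

text \<open>The quantifier over coefficients says that \<open>E\<close> is a basis of each tangent space over \<open>W\<close>.\<close>

definition local_frame ::
  "('a::topological_space, 'n::finite) chart set \<Rightarrow> 'a set \<Rightarrow> ('n \<Rightarrow> 'a vfield) \<Rightarrow> bool" where
  "local_frame A W E \<longleftrightarrow>
     (\<forall>i. smooth_vfield A W (E i)) \<and>
     (\<forall>q\<in>W. \<forall>v\<in>tangent_space A q. \<exists>!c :: 'n \<Rightarrow> real. v = (\<lambda>f. \<Sum>i\<in>UNIV. c i * E i q f))"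

locale riemannian_manifold = smooth_manifold A
  for A :: "('a::{t2_space, second_countable_topology}, 'n::finite) chart set" +
  fixes g :: "'a \<Rightarrow> 'a tangent \<Rightarrow> 'a tangent \<Rightarrow> real"
  assumes metric_sym:
      "u \<in> tangent_space A p \<Longrightarrow> v \<in> tangent_space A p \<Longrightarrow> g p u v = g p v u"
    and metric_linear:
      "u \<in> tangent_space A p \<Longrightarrow> v \<in> tangent_space A p \<Longrightarrow> w \<in> tangent_space A p \<Longrightarrow>
       g p (\<lambda>f. a * u f + b * v f) w = a * g p u w + b * g p v w"
    and metric_pos: "u \<in> tangent_space A p \<Longrightarrow> u \<noteq> (\<lambda>f. 0) \<Longrightarrow> g p u u > 0"
    and metric_smooth:
      "open V \<Longrightarrow> smooth_vfield A V X \<Longrightarrow> smooth_vfield A V Y \<Longrightarrow>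
       smooth_fun A V (\<lambda>p. g p (X p) (Y p))"

text \<open>\<open>D p v Y\<close> is the covariant derivative of the field \<open>Y\<close> at \<open>p\<close> in the direction
  \<open>v\<close>. The operator is given on fields defined on arbitrary open sets; locality says that only the
  germ of \<open>Y\<close> at \<open>p\<close> matters.\<close>

locale levi_civita_connection = riemannian_manifold A g
  for A :: "('a::{t2_space, second_countable_topology}, 'n::finite) chart set"
    and g :: "'a \<Rightarrow> 'a tangent \<Rightarrow> 'a tangent \<Rightarrow> real" +
  fixes D :: "'a \<Rightarrow> 'a tangent \<Rightarrow> 'a vfield \<Rightarrow> 'a tangent"
  assumes local:
      "open V \<Longrightarrow> p \<in> V \<Longrightarrow> smooth_vfield A V Y \<Longrightarrow> smooth_vfield A V Z \<Longrightarrow>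
       (\<And>q. q \<in> V \<Longrightarrow> Y q = Z q) \<Longrightarrow> v \<in> tangent_space A p \<Longrightarrow> D p v Y = D p v Z"
    and linear_direction:
      "open V \<Longrightarrow> p \<in> V \<Longrightarrow> smooth_vfield A V Y \<Longrightarrow>
       u \<in> tangent_space A p \<Longrightarrow> v \<in> tangent_space A p \<Longrightarrow>
       D p (\<lambda>f. a * u f + b * v f) Y = (\<lambda>f. a * D p u Y f + b * D p v Y f)"
    and additive:
      "open V \<Longrightarrow> p \<in> V \<Longrightarrow> smooth_vfield A V Y \<Longrightarrow> smooth_vfield A V Z \<Longrightarrow>
       v \<in> tangent_space A p \<Longrightarrow>
       D p v (\<lambda>q f. Y q f + Z q f) = (\<lambda>f. D p v Y f + D p v Z f)"
    and leibniz:
      "open V \<Longrightarrow> p \<in> V \<Longrightarrow> smooth_fun A V h \<Longrightarrow> smooth_vfield A V Y \<Longrightarrow>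
       v \<in> tangent_space A p \<Longrightarrow>
       D p v (\<lambda>q f. h q * Y q f) = (\<lambda>f. v h * Y p f + h p * D p v Y f)"
    and smooth:
      "open V \<Longrightarrow> smooth_vfield A V X \<Longrightarrow> smooth_vfield A V Y \<Longrightarrow>
       smooth_vfield A V (\<lambda>p. D p (X p) Y)"
    and torsion_free:
      "open V \<Longrightarrow> p \<in> V \<Longrightarrow> smooth_vfield A V X \<Longrightarrow> smooth_vfield A V Y \<Longrightarrow>
       (\<lambda>f. D p (X p) Y f - D p (Y p) X f) = lie_bracket A X Y p"
    and metric_compatible:
      "open V \<Longrightarrow> p \<in> V \<Longrightarrow> smooth_vfield A V Y \<Longrightarrow> smooth_vfield A V Z \<Longrightarrow>
       v \<in> tangent_space A p \<Longrightarrow>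
       v (\<lambda>q. g q (Y q) (Z q)) = g p (D p v Y) (Z p) + g p (Y p) (D p v Z)"

definition nabla ::
  "('a \<Rightarrow> 'a tangent \<Rightarrow> 'a vfield \<Rightarrow> 'a tangent) \<Rightarrow> 'a vfield \<Rightarrow> 'a vfield \<Rightarrow> 'a vfield" where
  "nabla D X Y = (\<lambda>p. D p (X p) Y)"

definition riemann ::
  "('a::topological_space, 'n::finite) chart set \<Rightarrow> ('a \<Rightarrow> 'a tangent \<Rightarrow> 'a tangent \<Rightarrow> real) \<Rightarrow>
   ('a \<Rightarrow> 'a tangent \<Rightarrow> 'a vfield \<Rightarrow> 'a tangent) \<Rightarrow>
   'a vfield \<Rightarrow> 'a vfield \<Rightarrow> 'a vfield \<Rightarrow> 'a vfield \<Rightarrow> 'a \<Rightarrow> real" where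
  "riemann A g D u v w z p =
     g p (\<lambda>f. nabla D u (nabla D v w) p f - nabla D v (nabla D u w) p f
              - nabla D (lie_bracket A u v) w p f) (z p)"

definition orthonormal_frame ::
  "('a::topological_space, 'n::finite) chart set \<Rightarrow> ('a \<Rightarrow> 'a tangent \<Rightarrow> 'a tangent \<Rightarrow> real) \<Rightarrow>
   'a set \<Rightarrow> ('n \<Rightarrow> 'a vfield) \<Rightarrow> bool" where
  "orthonormal_frame A g W E \<longleftrightarrow>
     local_frame A W E \<and> (\<forall>q\<in>W. \<forall>i j. g q (E i q) (E j q) = (if i = j then 1 else 0))"

text \<open>Some orthonormal frame on a neighbourhood of \<open>p\<close>; traces do not depend on the choice.\<close>

definition frame_near ::
  "('a::topological_space, 'n::finite) chart set \<Rightarrow> ('a \<Rightarrow> 'a tangent \<Rightarrow> 'a tangent \<Rightarrow> real) \<Rightarrow>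
   'a \<Rightarrow> 'n \<Rightarrow> 'a vfield" where
  "frame_near A g p = (SOME E. \<exists>W. open W \<and> p \<in> W \<and> orthonormal_frame A g W E)"

definition ricci ::
  "('a::topological_space, 'n::finite) chart set \<Rightarrow> ('a \<Rightarrow> 'a tangent \<Rightarrow> 'a tangent \<Rightarrow> real) \<Rightarrow>
   ('a \<Rightarrow> 'a tangent \<Rightarrow> 'a vfield \<Rightarrow> 'a tangent) \<Rightarrow> 'a vfield \<Rightarrow> 'a vfield \<Rightarrow> 'a \<Rightarrow> real" where
  "ricci A g D v w p =
     (\<Sum>i\<in>UNIV. riemann A g D (frame_near A g p i) v w (frame_near A g p i) p)"

definition scalar_curvature ::
  "('a::topological_space, 'n::finite) chart set \<Rightarrow> ('a \<Rightarrow> 'a tangent \<Rightarrow> 'a tangent \<Rightarrow> real) \<Rightarrow>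
   ('a \<Rightarrow> 'a tangent \<Rightarrow> 'a vfield \<Rightarrow> 'a tangent) \<Rightarrow> 'a \<Rightarrow> real" where
  "scalar_curvature A g D p =
     (\<Sum>i\<in>UNIV. ricci A g D (frame_near A g p i) (frame_near A g p i) p)"

definition divergence ::
  "('a::topological_space, 'n::finite) chart set \<Rightarrow> ('a \<Rightarrow> 'a tangent \<Rightarrow> 'a tangent \<Rightarrow> real) \<Rightarrow>
   ('a \<Rightarrow> 'a tangent \<Rightarrow> 'a vfield \<Rightarrow> 'a tangent) \<Rightarrow> 'a vfield \<Rightarrow> 'a \<Rightarrow> real" where
  "divergence A g D k p =
     (\<Sum>i\<in>UNIV. g p (D p (frame_near A g p i p) k) (frame_near A g p i p))"

definition unit_vfield ::
  "('a::topological_space, 'n::finite) chart set \<Rightarrow> ('a \<Rightarrow> 'a tangent \<Rightarrow> 'a tangent \<Rightarrow> real) \<Rightarrow>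
   'a set \<Rightarrow> 'a vfield \<Rightarrow> bool" where
  "unit_vfield A g U k \<longleftrightarrow> smooth_vfield A U k \<and> (\<forall>p\<in>U. g p (k p) (k p) = 1)"

text \<open>Every triple of tangent vectors at a point extends to smooth fields near that point, so
  testing on local fields is the vanishing of the tensor.\<close>

definition two_principal ::
  "('a::topological_space, 'n::finite) chart set \<Rightarrow> ('a \<Rightarrow> 'a tangent \<Rightarrow> 'a tangent \<Rightarrow> real) \<Rightarrow>
   ('a \<Rightarrow> 'a tangent \<Rightarrow> 'a vfield \<Rightarrow> 'a tangent) \<Rightarrow> 'a set \<Rightarrow> 'a vfield \<Rightarrow> bool" where
  "two_principal A g D U k \<longleftrightarrow>
     (\<forall>V v w z. open V \<and> V \<subseteq> U \<and>
        smooth_vfield A V v \<and> smooth_vfield A V w \<and> smooth_vfield A V z \<longrightarrow>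
        (\<forall>p\<in>V. riemann A g D k v w z p = 0))"

definition integral_curve ::
  "('a::topological_space, 'n::finite) chart set \<Rightarrow> 'a set \<Rightarrow> 'a vfield \<Rightarrow>
   real set \<Rightarrow> (real \<Rightarrow> 'a) \<Rightarrow> bool" where
  "integral_curve A U k I \<gamma> \<longleftrightarrow>
     open I \<and> is_interval I \<and> smooth_curve A I \<gamma> \<and>
     (\<forall>t\<in>I. \<gamma> t \<in> U \<and> velocity A \<gamma> t = k (\<gamma> t))"

text \<open>\<open>w\<close> is the covariant derivative at time \<open>t\<close> of the field \<open>X\<close> along \<open>\<gamma>\<close>: if
  \<open>X = \<Sum>i. a\<^sub>i (E\<^sub>i \<circ> \<gamma>)\<close> near \<open>t\<close> in a local frame \<open>E\<close>, then it is
  \<open>\<Sum>i. (a\<^sub>i' E\<^sub>i + a\<^sub>i \<nabla>\<^sub>\<gamma>\<^sub>' E\<^sub>i)\<close>, for one and hence every frame.\<close>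

definition has_covariant_derivative_along ::
  "('a::topological_space, 'n::finite) chart set \<Rightarrow>
   ('a \<Rightarrow> 'a tangent \<Rightarrow> 'a vfield \<Rightarrow> 'a tangent) \<Rightarrow>
   (real \<Rightarrow> 'a) \<Rightarrow> (real \<Rightarrow> 'a tangent) \<Rightarrow> real \<Rightarrow> 'a tangent \<Rightarrow> bool" where
  "has_covariant_derivative_along A D \<gamma> X t w \<longleftrightarrow>
     (\<exists>W E (a :: 'n \<Rightarrow> real \<Rightarrow> real) a'.
        open W \<and> \<gamma> t \<in> W \<and> local_frame A W E \<and>
        (\<forall>\<^sub>F s in nhds t. X s = (\<lambda>f. \<Sum>i\<in>UNIV. a i s * E i (\<gamma> s) f)) \<and>
        (\<forall>i. (a i has_real_derivative a' i) (at t)) \<and>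
        w = (\<lambda>f. \<Sum>i\<in>UNIV. a' i * E i (\<gamma> t) f + a i t * D (\<gamma> t) (velocity A \<gamma> t) (E i) f))"

definition geodesic ::
  "('a::topological_space, 'n::finite) chart set \<Rightarrow>
   ('a \<Rightarrow> 'a tangent \<Rightarrow> 'a vfield \<Rightarrow> 'a tangent) \<Rightarrow> real set \<Rightarrow> (real \<Rightarrow> 'a) \<Rightarrow> bool" where
  "geodesic A D I \<gamma> \<longleftrightarrow>
     open I \<and> is_interval I \<and> smooth_curve A I \<gamma> \<and>
     (\<forall>t\<in>I. has_covariant_derivative_along A D \<gamma> (velocity A \<gamma>) t (\<lambda>f. 0))"

end

theory Submission
  imports Defs
begin

text \<open>Write \<open>R(X, Y) = [\<nabla>\<^sub>X, \<nabla>\<^sub>Y] - \<nabla>\<^bsub>[X, Y]\<^esub>\<close>. Near each point of \<open>U\<close> there is an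
  orthonormal frame \<open>k, x, y\<close> that contains \<open>k\<close> (\<open>adapted_frame_near\<close>). The hypothesis says
  \<open>R(k, \<cdot>) = 0\<close>, the first Bianchi identity adds \<open>R(\<cdot>, \<cdot>) k = 0\<close>, and by skew-symmetry
  \<open>R(x, y)\<close> takes values in the plane of \<open>x\<close> and \<open>y\<close>, on which it is a rotation by a right angle
  times the sectional curvature \<open>\<kappa>\<close> of that plane. Hence \<open>S = 2 \<kappa>\<close>.

  The Jacobi identity for \<open>\<nabla>\<^sub>k, \<nabla>\<^sub>x, \<nabla>\<^sub>y\<close> is a form of the second Bianchi identity
  (\<open>second_bianchi\<close>). With \<open>R(k, \<cdot>) = 0\<close> it becomes
  \<open>[\<nabla>\<^sub>k, R(x, y)] + R(x, [y, k]) + R(y, [k, x]) = 0\<close>. Only the \<open>y\<close>-component of \<open>[y, k]\<close> and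
  the \<open>x\<close>-component of \<open>[k, x]\<close> matter, and they turn the last two terms into \<open>(div k) R(x, y)\<close>
  (\<open>bianchi_k\<close>):
  \<open>[\<nabla>\<^sub>k, R(x, y)] = - (div k) R(x, y)\<close>.

  Both claims are read off from this equation. Applied to \<open>y\<close>, its \<open>x\<close>-component is
  \<open>k[\<kappa>] = - (div k) \<kappa>\<close>. Applied to \<open>k\<close>, it says \<open>R(x, y) \<nabla>\<^sub>k k = 0\<close>, so
  \<open>\<nabla>\<^sub>k k = 0\<close> where \<open>\<kappa> \<noteq> 0\<close>. Finally, the first claim is a linear differential equation
  for \<open>S\<close> along an integral curve of \<open>k\<close>, so \<open>S\<close> vanishes everywhere on the curve or nowhere.

  The preparations have two aims. Coordinate fields of a chart and Gram--Schmidt yield smooth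
  orthonormal frames (\<open>orthonormal_on_extend_frame\<close>), and linearity over functions shows that the
  traces in \<open>S\<close> and \<open>div k\<close> may be computed in any of them (\<open>trace_frame_independent\<close>).\<close>

section \<open>Calculus of smooth functions on open sets\<close>

lemma has_derivative_cong_open:
  assumes "open S" "x \<in> S" "\<And>y. y \<in> S \<Longrightarrow> f y = g y"
  shows "(f has_derivative f') (at x) \<longleftrightarrow> (g has_derivative f') (at x)"
  using assms by (metis has_derivative_transform_within_open)

lemma frechet_derivative_cong_open:
  assumes "open S" "x \<in> S" "\<And>y. y \<in> S \<Longrightarrow> f y = g y"
  shows "frechet_derivative f (at x) = frechet_derivative g (at x)"
  unfolding frechet_derivative_def using has_derivative_cong_open[OF assms] by simp

lemma times_differentiable_on_cong:
  assumes "open S" "\<And>x. x \<in> S \<Longrightarrow> f x = g x"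
  shows "times_differentiable_on n S f \<longleftrightarrow> times_differentiable_on n S g"
  using assms(2)
proof (induction n arbitrary: f g)
  case 0
  then show ?case by (auto cong: continuous_on_cong)
next
  case (Suc n)
  have "times_differentiable_on n S (\<lambda>x. frechet_derivative f (at x) v) \<longleftrightarrow>
        times_differentiable_on n S (\<lambda>x. frechet_derivative g (at x) v)" for v
    by (rule Suc.IH) (simp add: frechet_derivative_cong_open[OF assms(1) _ Suc.prems])
  moreover have "f differentiable (at x) \<longleftrightarrow> g differentiable (at x)" if "x \<in> S" for x
    unfolding differentiable_def using has_derivative_cong_open[OF assms(1) that Suc.prems] by auto
  ultimately show ?case by auto
qed

lemma smooth_on_cong:
  assumes "open S" "\<And>x. x \<in> S \<Longrightarrow> f x = g x"
  shows "smooth_on S f \<longleftrightarrow> smooth_on S g"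
  unfolding smooth_on_def using times_differentiable_on_cong[OF assms] by simp

lemma times_differentiable_on_Suc_imp:
  "times_differentiable_on (Suc n) S f \<Longrightarrow> times_differentiable_on n S f"
proof (induction n arbitrary: f)
  case 0
  then show ?case
    by (simp add: continuous_at_imp_continuous_on differentiable_imp_continuous_within)
next
  case (Suc n)
  then show ?case by (metis times_differentiable_on.simps(2))
qed

lemma times_differentiable_on_mono:
  "times_differentiable_on n S f \<Longrightarrow> T \<subseteq> S \<Longrightarrow> times_differentiable_on n T f"
  by (induction n arbitrary: f) (auto intro: continuous_on_subset)

lemma smooth_on_mono: "smooth_on S f \<Longrightarrow> T \<subseteq> S \<Longrightarrow> smooth_on T f"
  unfolding smooth_on_def using times_differentiable_on_mono by blast

lemma smooth_on_imp_differentiable: "smooth_on S f \<Longrightarrow> x \<in> S \<Longrightarrow> f differentiable (at x)"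
  unfolding smooth_on_def by (metis times_differentiable_on.simps(2))

lemma smooth_on_imp_continuous_on: "smooth_on S f \<Longrightarrow> continuous_on S f"
  unfolding smooth_on_def by (metis times_differentiable_on.simps(1))

lemma smooth_on_frechet_derivative:
  "smooth_on S f \<Longrightarrow> smooth_on S (\<lambda>x. frechet_derivative f (at x) v)"
  unfolding smooth_on_def by (metis times_differentiable_on.simps(2))

lemma times_differentiable_on_const: "times_differentiable_on n S (\<lambda>x. c)"
  by (induction n arbitrary: c) (auto simp: frechet_derivative_const)

lemma smooth_on_const: "smooth_on S (\<lambda>x. c)"
  unfolding smooth_on_def by (simp add: times_differentiable_on_const)

lemma frechet_derivative_add:
  assumes "f differentiable (at x)" "g differentiable (at x)"
  shows "frechet_derivative (\<lambda>x. f x + g x) (at x) v =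
           frechet_derivative f (at x) v + frechet_derivative g (at x) v"
proof -
  have "((\<lambda>x. f x + g x) has_derivative
          (\<lambda>v. frechet_derivative f (at x) v + frechet_derivative g (at x) v)) (at x)"
    using assms unfolding frechet_derivative_works by (rule has_derivative_add)
  then show ?thesis by (simp add: frechet_derivative_at[symmetric])
qed

lemma times_differentiable_on_add:
  assumes "open S" "times_differentiable_on n S f" "times_differentiable_on n S g"
  shows "times_differentiable_on n S (\<lambda>x. f x + g x)"
  using assms(2,3)
proof (induction n arbitrary: f g)
  case 0
  then show ?case by (auto intro: continuous_intros)
next
  case (Suc n)
  have "times_differentiable_on n S (\<lambda>x. frechet_derivative (\<lambda>x. f x + g x) (at x) v)" for v
  proof -
    have "times_differentiable_on n S
            (\<lambda>x. frechet_derivative f (at x) v + frechet_derivative g (at x) v)"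
      using Suc by auto
    then show ?thesis
      using Suc.prems
      by (subst times_differentiable_on_cong[OF assms(1)])
         (auto simp: frechet_derivative_add)
  qed
  then show ?case using Suc.prems by auto
qed

lemma times_differentiable_on_sum:
  assumes "open S" "\<And>i. i \<in> I \<Longrightarrow> times_differentiable_on n S (f i)"
  shows "times_differentiable_on n S (\<lambda>x. \<Sum>i\<in>I. f i x)"
  using assms(2)
  by (induction I rule: infinite_finite_induct)
     (auto simp: times_differentiable_on_const intro: times_differentiable_on_add[OF assms(1)])

lemma frechet_derivative_mult_real:
  fixes f g :: "'b::real_normed_vector \<Rightarrow> real"
  assumes "f differentiable (at x)" "g differentiable (at x)"
  shows "frechet_derivative (\<lambda>x. f x * g x) (at x) v =
           f x * frechet_derivative g (at x) v + frechet_derivative f (at x) v * g x"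
proof -
  have "((\<lambda>x. f x * g x) has_derivative
          (\<lambda>v. f x * frechet_derivative g (at x) v + frechet_derivative f (at x) v * g x)) (at x)"
    using assms unfolding frechet_derivative_works by (rule has_derivative_mult)
  then show ?thesis by (simp add: frechet_derivative_at[symmetric])
qed

lemma times_differentiable_on_mult:
  fixes f g :: "'b::real_normed_vector \<Rightarrow> real"
  assumes "open S" "times_differentiable_on n S f" "times_differentiable_on n S g"
  shows "times_differentiable_on n S (\<lambda>x. f x * g x)"
  using assms(2,3)
proof (induction n arbitrary: f g)
  case 0
  then show ?case by (auto intro: continuous_intros)
next
  case (Suc n)
  have "times_differentiable_on n S (\<lambda>x. frechet_derivative (\<lambda>x. f x * g x) (at x) v)" for v
  proof -
    have "times_differentiable_on n S
            (\<lambda>x. f x * frechet_derivative g (at x) v + frechet_derivative f (at x) v * g x)"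
      using Suc.prems times_differentiable_on_Suc_imp[OF Suc.prems(1)]
        times_differentiable_on_Suc_imp[OF Suc.prems(2)]
      by (intro times_differentiable_on_add[OF assms(1)] Suc.IH) auto
    then show ?thesis
      using Suc.prems
      by (subst times_differentiable_on_cong[OF assms(1)])
         (auto simp: frechet_derivative_mult_real)
  qed
  then show ?case using Suc.prems by auto
qed

text \<open>Normalising a vector field calls for \<open>f powr (-1/2)\<close>. The derivative of a power is a
  multiple of another power, so treating all exponents at once makes the induction close.\<close>

lemma smooth_on_powr:
  fixes f :: "'b::real_normed_vector \<Rightarrow> real"
  assumes "open S" "smooth_on S f" "\<And>x. x \<in> S \<Longrightarrow> f x > 0"
  shows "smooth_on S (\<lambda>x. f x powr a)"
proof -
  have "times_differentiable_on n S (\<lambda>x. f x powr a)" for n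
  proof (induction n arbitrary: a)
    case 0
    then show ?case
      using smooth_on_imp_continuous_on[OF assms(2)] assms(3)
      by (auto intro!: continuous_intros simp: less_imp_neq[THEN not_sym])
  next
    case (Suc n)
    have der: "((\<lambda>x. f x powr a) has_derivative
        (\<lambda>v. frechet_derivative f (at x) v * (a * f x powr (a - 1)))) (at x)" if "x \<in> S" for x
    proof -
      have "(f has_derivative frechet_derivative f (at x)) (at x)"
        using smooth_on_imp_differentiable[OF assms(2) that] frechet_derivative_works by blast
      moreover have "((\<lambda>y. y powr a) has_derivative (\<lambda>h. h * (a * f x powr (a - 1)))) (at (f x))"
        using has_real_derivative_powr[OF assms(3)[OF that], of a]
        by (simp add: has_field_derivative_def mult.commute[of _ "a * f x powr (a - 1)"])
      ultimately show ?thesis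
        using has_derivative_compose by blast
    qed
    have "times_differentiable_on n S (\<lambda>x. frechet_derivative (\<lambda>x. f x powr a) (at x) v)" for v
    proof -
      have "times_differentiable_on n S (\<lambda>x. frechet_derivative f (at x) v * (a * f x powr (a - 1)))"
        using Suc smooth_on_frechet_derivative[OF assms(2), of v]
        by (intro times_differentiable_on_mult[OF assms(1)])
           (auto simp: smooth_on_def times_differentiable_on_const)
      then show ?thesis
        by (subst times_differentiable_on_cong[OF assms(1)])
           (auto dest!: der simp: frechet_derivative_at[symmetric])
    qed
    then show ?case using der by (auto simp: differentiable_def)
  qed
  then show ?thesis unfolding smooth_on_def by blast
qed

lemma smooth_on_add:
  "open S \<Longrightarrow> smooth_on S f \<Longrightarrow> smooth_on S g \<Longrightarrow> smooth_on S (\<lambda>x. f x + g x)"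
  unfolding smooth_on_def using times_differentiable_on_add by blast

lemma smooth_on_mult:
  fixes f g :: "'b::real_normed_vector \<Rightarrow> real"
  shows "open S \<Longrightarrow> smooth_on S f \<Longrightarrow> smooth_on S g \<Longrightarrow> smooth_on S (\<lambda>x. f x * g x)"
  unfolding smooth_on_def using times_differentiable_on_mult by blast

lemma smooth_on_bounded_linear:
  assumes "bounded_linear L" "open S" "smooth_on S f"
  shows "smooth_on S (\<lambda>x. L (f x))"
proof -
  have "times_differentiable_on n S (\<lambda>x. L (f x))"
    if "times_differentiable_on n S f" for n
    using that
  proof (induction n arbitrary: f)
    case 0
    then show ?case
      using bounded_linear.continuous_on[OF assms(1)] by auto
  next
    case (Suc n)
    have der: "((\<lambda>x. L (f x)) has_derivative (\<lambda>v. L (frechet_derivative f (at x) v))) (at x)"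
      if "x \<in> S" for x
      using Suc.prems that frechet_derivative_works
      by (intro bounded_linear.has_derivative[OF assms(1)]) auto
    have "times_differentiable_on n S (\<lambda>x. frechet_derivative (\<lambda>x. L (f x)) (at x) v)" for v
      using Suc
      by (subst times_differentiable_on_cong[OF assms(2), of _ "\<lambda>x. L (frechet_derivative f (at x) v)"])
         (auto dest!: der simp: frechet_derivative_at[symmetric])
    then show ?case using der by (auto simp: differentiable_def)
  qed
  then show ?thesis using assms(3) unfolding smooth_on_def by blast
qed

lemma frechet_derivative_sum_axis:
  fixes f :: "real ^ 'n \<Rightarrow> real"
  assumes "f differentiable (at x)"
  shows "frechet_derivative f (at x) w = (\<Sum>i\<in>UNIV. w $ i * frechet_derivative f (at x) (axis i 1))"
proof -
  interpret L: linear "frechet_derivative f (at x)"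
    by (rule linear_frechet_derivative[OF assms])
  have "frechet_derivative f (at x) w =
        frechet_derivative f (at x) (\<Sum>i\<in>UNIV. (w $ i) *\<^sub>R axis i 1)"
    by (simp add: basis_expansion flip: scalar_mult_eq_scaleR)
  then show ?thesis by (simp add: L.sum L.scale)
qed

text \<open>The chain rule turns a directional derivative of \<open>f \<circ> T\<close> into a sum of products of
  the composites \<open>(\<partial>\<^sub>i f) \<circ> T\<close> with derivatives of \<open>T\<close>, and the
  induction hypothesis is available for the former because it speaks of all smooth \<open>f\<close>.\<close>

lemma smooth_on_compose:
  fixes f :: "real ^ 'n \<Rightarrow> real" and T :: "'b::real_normed_vector \<Rightarrow> real ^ 'n"
  assumes "open S" "open R" "smooth_on S T" "T ` S \<subseteq> R" "smooth_on R f"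
  shows "smooth_on S (f \<circ> T)"
proof -
  have "times_differentiable_on n S (f \<circ> T)" for n
    using assms(5)
  proof (induction n arbitrary: f)
    case 0
    then show ?case
      using continuous_on_compose[OF smooth_on_imp_continuous_on[OF assms(3)]]
        continuous_on_subset[OF smooth_on_imp_continuous_on[OF 0] assms(4)] by simp
  next
    case (Suc n)
    have der: "((f \<circ> T) has_derivative
        (\<lambda>v. \<Sum>i\<in>UNIV. (frechet_derivative T (at x) v) $ i *
                 frechet_derivative f (at (T x)) (axis i 1))) (at x)" if "x \<in> S" for x
    proof -
      have T: "(T has_derivative frechet_derivative T (at x)) (at x)"
        using smooth_on_imp_differentiable[OF assms(3) that] frechet_derivative_works by blast
      have df: "f differentiable (at (T x))"
        using smooth_on_imp_differentiable[OF Suc.prems] assms(4) that by blast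
      then have f: "(f has_derivative frechet_derivative f (at (T x))) (at (T x))"
        using frechet_derivative_works by blast
      show ?thesis
        using diff_chain_at[OF T f] unfolding comp_def frechet_derivative_sum_axis[OF df, of "frechet_derivative T (at x) _"] .
    qed
    have "times_differentiable_on n S (\<lambda>x. frechet_derivative (f \<circ> T) (at x) v)" for v
    proof -
      have "times_differentiable_on n S (\<lambda>x. \<Sum>i\<in>UNIV. (frechet_derivative T (at x) v) $ i *
                 ((\<lambda>y. frechet_derivative f (at y) (axis i 1)) \<circ> T) x)"
      proof (intro times_differentiable_on_sum times_differentiable_on_mult assms(1))
        fix i
        show "times_differentiable_on n S (\<lambda>x. frechet_derivative T (at x) v $ i)"
          using smooth_on_bounded_linear[OF bounded_linear_vec_nth assms(1)
              smooth_on_frechet_derivative[OF assms(3)]]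
          unfolding smooth_on_def by blast
        show "times_differentiable_on n S (\<lambda>x. ((\<lambda>y. frechet_derivative f (at y) (axis i 1)) \<circ> T) x)"
          using Suc.IH[OF smooth_on_frechet_derivative[OF Suc.prems]] by (simp add: comp_def)
      qed
      then show ?thesis
        by (subst times_differentiable_on_cong[OF assms(1)])
           (auto dest!: der simp: frechet_derivative_at[symmetric])
    qed
    then show ?case using der by (simp add: differentiable_def o_def, blast)
  qed
  then show ?thesis unfolding smooth_on_def by blast
qed


text \<open>The derivative of such a function in the direction \<open>v\<close> has the same form again, with \<open>f\<close>
  replaced by its derivative in the direction \<open>v *\<^sub>R c\<close>.\<close>

lemma smooth_on_compose_line:
  fixes f :: "'b::real_normed_vector \<Rightarrow> 'c::real_normed_vector"
  assumes "open I" "smooth_on R f" "(\<lambda>t. a + t *\<^sub>R c) ` I \<subseteq> R"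
  shows "smooth_on I (\<lambda>t::real. f (a + t *\<^sub>R c))"
proof -
  have "times_differentiable_on n I (\<lambda>t::real. f (a + t *\<^sub>R c))" for n
    using assms(2)
  proof (induction n arbitrary: f)
    case 0
    show ?case
    proof -
      have "continuous_on I (\<lambda>t. a + t *\<^sub>R c)" by (intro continuous_intros)
      from continuous_on_compose2[OF smooth_on_imp_continuous_on[OF 0] this assms(3)]
      show ?thesis by simp
    qed
  next
    case (Suc n)
    have der: "((\<lambda>t. f (a + t *\<^sub>R c)) has_derivative
        (\<lambda>v. frechet_derivative f (at (a + t *\<^sub>R c)) (v *\<^sub>R c))) (at t)" if "t \<in> I" for t
    proof -
      have "f differentiable (at (a + t *\<^sub>R c))"
        using smooth_on_imp_differentiable[OF Suc.prems] assms(3) that by blast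
      then have "(f has_derivative frechet_derivative f (at (a + t *\<^sub>R c))) (at (a + t *\<^sub>R c))"
        using frechet_derivative_works by blast
      moreover have "((\<lambda>t. a + t *\<^sub>R c) has_derivative (\<lambda>v. v *\<^sub>R c)) (at t)"
        by (auto intro!: derivative_eq_intros)
      ultimately show ?thesis
        using has_derivative_compose by blast
    qed
    have "times_differentiable_on n I (\<lambda>t. frechet_derivative (\<lambda>t. f (a + t *\<^sub>R c)) (at t) v)" for v
      using Suc.IH[OF smooth_on_frechet_derivative[OF Suc.prems], of "v *\<^sub>R c"]
      by (subst times_differentiable_on_cong[OF assms(1)])
         (auto dest!: der simp: frechet_derivative_at[symmetric])
    then show ?case using der by (auto simp: differentiable_def)
  qed
  then show ?thesis unfolding smooth_on_def by blast
qed

section \<open>Smooth functions and tangent vectors\<close>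

context smooth_manifold
begin

lemma chart_inverse: "(C, \<phi>) \<in> A \<Longrightarrow> q \<in> C \<Longrightarrow> inv_into C \<phi> (\<phi> q) = q"
  using chart_homeomorphism homeomorphism_apply1 by blast

lemma chart_at: obtains C \<phi> where "(C, \<phi>) \<in> A" "p \<in> C"
  using covering by fastforce

lemma open_chart_image:
  assumes "(C, \<phi>) \<in> A" "open W"
  shows "open (\<phi> ` (C \<inter> W))"
  using homeomorphism_imp_open_map[OF chart_homeomorphism[OF assms(1)]]
    openin_open_Int[OF assms(2)] openin_open_trans open_range[OF assms(1)] by blast

lemma smooth_funI:
  assumes "\<And>C \<phi>. (C, \<phi>) \<in> A \<Longrightarrow> smooth_on (\<phi> ` (C \<inter> V)) (f \<circ> inv_into C \<phi>)"
  shows "smooth_fun A V f"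
  using assms unfolding smooth_fun_def by blast

lemma smooth_funD:
  "smooth_fun A V f \<Longrightarrow> (C, \<phi>) \<in> A \<Longrightarrow> smooth_on (\<phi> ` (C \<inter> V)) (f \<circ> inv_into C \<phi>)"
  unfolding smooth_fun_def by blast

lemma smooth_fun_mono: "smooth_fun A V f \<Longrightarrow> W \<subseteq> V \<Longrightarrow> smooth_fun A W f"
  by (rule smooth_funI, rule smooth_on_mono[OF smooth_funD]) auto

lemma smooth_fun_cong:
  assumes "open V" "\<And>q. q \<in> V \<Longrightarrow> f q = h q"
  shows "smooth_fun A V f \<longleftrightarrow> smooth_fun A V h"
proof -
  have "smooth_on (\<phi> ` (C \<inter> V)) (f \<circ> inv_into C \<phi>) \<longleftrightarrow>
        smooth_on (\<phi> ` (C \<inter> V)) (h \<circ> inv_into C \<phi>)" if "(C, \<phi>) \<in> A" for C \<phi>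
    using assms(2) chart_inverse[OF that]
    by (intro smooth_on_cong[OF open_chart_image[OF that assms(1)]]) auto
  then show ?thesis unfolding smooth_fun_def by blast
qed

lemma smooth_fun_const: "smooth_fun A V (\<lambda>q. c)"
  by (rule smooth_funI) (simp add: comp_def smooth_on_const)

lemma smooth_fun_add:
  "open V \<Longrightarrow> smooth_fun A V f \<Longrightarrow> smooth_fun A V h \<Longrightarrow> smooth_fun A V (\<lambda>q. f q + h q)"
  using smooth_on_add[OF open_chart_image smooth_funD smooth_funD]
  by (intro smooth_funI) (simp add: comp_def)

lemma smooth_fun_mult:
  "open V \<Longrightarrow> smooth_fun A V f \<Longrightarrow> smooth_fun A V h \<Longrightarrow> smooth_fun A V (\<lambda>q. f q * h q)"
  using smooth_on_mult[OF open_chart_image smooth_funD smooth_funD]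
  by (intro smooth_funI) (simp add: comp_def)

lemma smooth_fun_powr:
  assumes "open V" "smooth_fun A V f" "\<And>q. q \<in> V \<Longrightarrow> f q > 0"
  shows "smooth_fun A V (\<lambda>q. f q powr a)"
proof (rule smooth_funI)
  fix C \<phi> assume C: "(C, \<phi>) \<in> A"
  have "(f \<circ> inv_into C \<phi>) x > 0" if "x \<in> \<phi> ` (C \<inter> V)" for x
    using that chart_inverse[OF C] assms(3) by auto
  from smooth_on_powr[OF open_chart_image[OF C assms(1)] smooth_funD[OF assms(2) C] this]
  show "smooth_on (\<phi> ` (C \<inter> V)) ((\<lambda>q. f q powr a) \<circ> inv_into C \<phi>)"
    by (simp add: comp_def)
qed

lemma smooth_fun_diff:
  "open V \<Longrightarrow> smooth_fun A V f \<Longrightarrow> smooth_fun A V h \<Longrightarrow> smooth_fun A V (\<lambda>q. f q - h q)"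
  using smooth_fun_add[of V f "\<lambda>q. (-1) * h q"] smooth_fun_mult[OF _ smooth_fun_const[of V "-1"]]
  by simp

lemma smooth_fun_continuous_on:
  assumes "open V" "smooth_fun A V f"
  shows "continuous_on V f"
proof -
  have "continuous (at p) f" if p: "p \<in> V" for p
  proof -
    obtain C \<phi> where C: "(C, \<phi>) \<in> A" "p \<in> C" by (rule chart_at)
    have "continuous_on (C \<inter> V) ((f \<circ> inv_into C \<phi>) \<circ> \<phi>)"
      using homeomorphism_cont1[OF chart_homeomorphism[OF C(1)]]
        smooth_on_imp_continuous_on[OF smooth_funD[OF assms(2) C(1)]]
      by (intro continuous_on_compose[where f = \<phi>]) (auto intro: continuous_on_subset)
    then have "continuous_on (C \<inter> V) f"
      by (rule continuous_on_eq) (use chart_inverse[OF C(1)] in auto)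
    then show ?thesis
      using C p assms(1) open_domain continuous_on_eq_continuous_at open_Int by blast
  qed
  then show ?thesis by (simp add: continuous_at_imp_continuous_on)
qed

text \<open>The transition maps being smooth, one chart suffices to test smoothness.\<close>

lemma smooth_fun_chartI:
  assumes C: "(C, \<phi>) \<in> A" and W: "open W" "W \<subseteq> C"
    and f: "smooth_on (\<phi> ` W) (f \<circ> inv_into C \<phi>)"
  shows "smooth_fun A W f"
proof (rule smooth_funI)
  fix C' \<psi> assume C': "(C', \<psi>) \<in> A"
  let ?T = "\<phi> \<circ> inv_into C' \<psi>" and ?S = "\<psi> ` (C' \<inter> W)"
  have S: "open ?S" by (rule open_chart_image[OF C' W(1)])
  have "smooth_on ?S ?T"
    by (rule smooth_on_mono[OF smooth_transition[OF C' C]]) (use W in auto)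
  moreover have "open (\<phi> ` W)"
    using open_chart_image[OF C W(1)] W(2) by (simp add: inf_absorb2)
  moreover have "?T ` ?S \<subseteq> \<phi> ` W"
    using chart_inverse[OF C'] by auto
  ultimately have "smooth_on ?S ((f \<circ> inv_into C \<phi>) \<circ> ?T)"
    using f S by (intro smooth_on_compose)
  moreover have "((f \<circ> inv_into C \<phi>) \<circ> ?T) x = (f \<circ> inv_into C' \<psi>) x" if "x \<in> ?S" for x
  proof -
    obtain q where q: "q \<in> C'" "q \<in> W" "x = \<psi> q" using \<open>x \<in> ?S\<close> by blast
    then show ?thesis
      using chart_inverse[OF C' q(1)] chart_inverse[OF C, of q] W(2) by auto
  qed
  ultimately show "smooth_on ?S (f \<circ> inv_into C' \<psi>)"
    using smooth_on_cong[OF S] by blast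
qed

lemma smooth_nearI: "open V \<Longrightarrow> p \<in> V \<Longrightarrow> smooth_fun A V f \<Longrightarrow> smooth_near A p f"
  unfolding smooth_near_def by blast

lemma smooth_near_cong:
  assumes "open V" "p \<in> V" "\<And>q. q \<in> V \<Longrightarrow> f q = h q"
  shows "smooth_near A p f \<longleftrightarrow> smooth_near A p h"
proof -
  have germ: "smooth_near A p h'"
    if f': "smooth_near A p f'" and eq: "\<And>q. q \<in> V \<Longrightarrow> f' q = h' q" for f' h'
  proof -
    obtain W where W: "open W" "p \<in> W" "smooth_fun A W f'"
      using f' unfolding smooth_near_def by blast
    have o: "open (V \<inter> W)" "p \<in> V \<inter> W" using W assms(1,2) by auto
    have "smooth_fun A (V \<inter> W) f'" using smooth_fun_mono[OF W(3)] by blast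
    then have "smooth_fun A (V \<inter> W) h'"
      using smooth_fun_cong[OF o(1), of f' h'] eq by blast
    then show ?thesis by (rule smooth_nearI[OF o])
  qed
  show ?thesis
    using germ[of f h] germ[of h f] assms(3) by metis
qed

text \<open>In a chart, the tangent vectors at \<open>p\<close> are the directional derivatives. This gives their
  algebraic properties and a basis of each tangent space.\<close>

definition chart_vector :: "'a set \<Rightarrow> ('a \<Rightarrow> real ^ 'n) \<Rightarrow> 'a \<Rightarrow> real ^ 'n \<Rightarrow> 'a tangent" where
  "chart_vector C \<phi> p c =
     (\<lambda>f. if smooth_near A p f then frechet_derivative (f \<circ> inv_into C \<phi>) (at (\<phi> p)) c else 0)"

lemma smooth_near_chart_differentiable:
  assumes "(C, \<phi>) \<in> A" "p \<in> C" "smooth_near A p f"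
  shows "(f \<circ> inv_into C \<phi>) differentiable (at (\<phi> p))"
proof -
  obtain V where "open V" "p \<in> V" "smooth_fun A V f"
    using assms(3) unfolding smooth_near_def by blast
  then show ?thesis
    using smooth_on_imp_differentiable[OF smooth_funD[OF _ assms(1)]] assms(2) by blast
qed

lemma open_curve_in_chart:
  assumes "smooth_curve A I \<gamma>" "open I" "(C, \<phi>) \<in> A"
  shows "open {t \<in> I. \<gamma> t \<in> C}"
proof -
  have "open (I \<inter> \<gamma> -` C)"
    using assms(1) unfolding smooth_curve_def
    by (intro continuous_open_preimage[OF _ assms(2) open_domain[OF assms(3)]]) blast
  then show ?thesis by (simp add: vimage_def Collect_conj_eq)
qed

lemma curve_has_derivative:
  assumes \<gamma>: "smooth_curve A I \<gamma>" "open I" "t \<in> I"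
    and C: "(C, \<phi>) \<in> A" "\<gamma> t \<in> C" and f: "smooth_near A (\<gamma> t) f"
  shows "((f \<circ> \<gamma>) has_real_derivative
           frechet_derivative (f \<circ> inv_into C \<phi>) (at (\<phi> (\<gamma> t)))
             (frechet_derivative (\<phi> \<circ> \<gamma>) (at t) 1)) (at t)"
proof -
  let ?I = "{t \<in> I. \<gamma> t \<in> C}"
  let ?F = "frechet_derivative (f \<circ> inv_into C \<phi>) (at (\<phi> (\<gamma> t)))"
  let ?G = "frechet_derivative (\<phi> \<circ> \<gamma>) (at t)"
  have "smooth_on ?I (\<phi> \<circ> \<gamma>)"
    using \<gamma>(1) C(1) unfolding smooth_curve_def by blast
  then have dG: "(\<phi> \<circ> \<gamma>) differentiable (at t)"
    by (rule smooth_on_imp_differentiable) (use \<gamma> C in auto)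
  then have G: "((\<phi> \<circ> \<gamma>) has_derivative ?G) (at t)"
    using frechet_derivative_works by blast
  have dF: "(f \<circ> inv_into C \<phi>) differentiable (at ((\<phi> \<circ> \<gamma>) t))"
    using smooth_near_chart_differentiable[OF C f] by simp
  then have F: "((f \<circ> inv_into C \<phi>) has_derivative ?F) (at ((\<phi> \<circ> \<gamma>) t))"
    using frechet_derivative_works by fastforce
  have "((f \<circ> inv_into C \<phi>) \<circ> (\<phi> \<circ> \<gamma>) has_derivative ?F \<circ> ?G) (at t)"
    by (rule diff_chain_at[OF G F])
  then have "((f \<circ> \<gamma>) has_derivative ?F \<circ> ?G) (at t)"
    by (rule has_derivative_transform_within_open[OF _ open_curve_in_chart[OF \<gamma>(1,2) C(1)]])
       (use \<gamma> C chart_inverse in auto)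
  moreover have "(?F \<circ> ?G) h = ?F (?G 1) * h" for h
  proof -
    have "?G h = h *\<^sub>R ?G 1"
      using linear_scale[OF linear_frechet_derivative[OF dG], of h 1] by simp
    then show ?thesis
      using linear_scale[OF linear_frechet_derivative[OF dF], of h "?G 1"] by simp
  qed
  ultimately show ?thesis
    unfolding has_field_derivative_def by (metis (no_types, lifting) ext)
qed

lemma velocity_chart:
  assumes "smooth_curve A I \<gamma>" "open I" "t \<in> I" "(C, \<phi>) \<in> A" "\<gamma> t \<in> C"
  shows "velocity A \<gamma> t = chart_vector C \<phi> (\<gamma> t) (frechet_derivative (\<phi> \<circ> \<gamma>) (at t) 1)"
  using DERIV_imp_deriv[OF curve_has_derivative[OF assms]]
  by (auto simp: velocity_def chart_vector_def fun_eq_iff)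

lemma velocity_has_derivative:
  assumes "smooth_curve A I \<gamma>" "open I" "t \<in> I" "smooth_near A (\<gamma> t) f"
  shows "((f \<circ> \<gamma>) has_real_derivative velocity A \<gamma> t f) (at t)"
proof -
  obtain C \<phi> where C: "(C, \<phi>) \<in> A" "\<gamma> t \<in> C" by (rule chart_at)
  show ?thesis
    using curve_has_derivative[OF assms(1-3) C assms(4)] assms(4)
    by (simp add: velocity_chart[OF assms(1-3) C] chart_vector_def)
qed

text \<open>A directional derivative is the velocity of a line in the chart.\<close>

lemma chart_vector_in_tangent_space:
  assumes C: "(C, \<phi>) \<in> A" and p: "p \<in> C"
  shows "chart_vector C \<phi> p c \<in> tangent_space A p"
proof -
  let ?l = "\<lambda>t::real. \<phi> p + t *\<^sub>R c"
  define \<gamma> where "\<gamma> = (\<lambda>t. inv_into C \<phi> (?l t))"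
  have cl: "continuous_on S ?l" for S by (intro continuous_intros)
  have "open (?l -` (\<phi> ` C))"
    by (rule continuous_open_vimage[OF open_range[OF C]])
       (use cl[of UNIV] in \<open>simp add: continuous_on_eq_continuous_at\<close>)
  moreover have "0 \<in> ?l -` (\<phi> ` C)" using p by simp
  ultimately obtain \<epsilon> where \<epsilon>: "\<epsilon> > 0" "ball 0 \<epsilon> \<subseteq> ?l -` (\<phi> ` C)"
    using openE by blast
  define I where "I = {-\<epsilon><..<\<epsilon>}"
  have l: "?l t \<in> \<phi> ` C" if "t \<in> I" for t
  proof -
    have "t \<in> ball 0 \<epsilon>" using that by (auto simp: I_def)
    then show ?thesis using \<epsilon>(2) by blast
  qed
  have \<gamma>: "\<gamma> t \<in> C" "\<phi> (\<gamma> t) = ?l t" if "t \<in> I" for t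
    using l[OF that] by (auto simp: \<gamma>_def inv_into_into f_inv_into_f)
  have I: "open I" "0 \<in> I" using \<epsilon> by (auto simp: I_def)
  have cont: "continuous_on I \<gamma>"
    unfolding \<gamma>_def
    by (rule continuous_on_compose2[OF homeomorphism_cont2[OF chart_homeomorphism[OF C]] cl])
       (use l in auto)
  have "smooth_on {t \<in> I. \<gamma> t \<in> C'} (\<psi> \<circ> \<gamma>)" if C': "(C', \<psi>) \<in> A" for C' \<psi>
  proof -
    have "open (I \<inter> \<gamma> -` C')"
      by (rule continuous_open_preimage[OF cont I(1) open_domain[OF C']])
    then have "open {t \<in> I. \<gamma> t \<in> C'}" by (simp add: vimage_def Collect_conj_eq)
    then have "smooth_on {t \<in> I. \<gamma> t \<in> C'} (\<lambda>t. (\<psi> \<circ> inv_into C \<phi>) (?l t))"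
      by (rule smooth_on_compose_line[OF _ smooth_transition[OF C C']])
         (use \<gamma> in \<open>force simp flip: \<gamma>(2)\<close>)
    then show ?thesis by (simp add: comp_def \<gamma>_def)
  qed
  then have sm: "smooth_curve A I \<gamma>"
    using cont unfolding smooth_curve_def by blast
  have \<gamma>0: "\<gamma> 0 = p" using chart_inverse[OF C p] by (simp add: \<gamma>_def)
  have "(?l has_derivative (\<lambda>h. h *\<^sub>R c)) (at 0)"
    by (auto intro!: derivative_eq_intros)
  then have "((\<phi> \<circ> \<gamma>) has_derivative (\<lambda>h. h *\<^sub>R c)) (at 0)"
    by (rule has_derivative_transform_within_open[OF _ I]) (simp add: \<gamma>)
  then have "frechet_derivative (\<phi> \<circ> \<gamma>) (at 0) 1 = c"
    by (simp add: frechet_derivative_at[symmetric])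
  then have "velocity A \<gamma> 0 = chart_vector C \<phi> p c"
    using velocity_chart[OF sm I C] p \<gamma>0 by simp
  then show ?thesis
    using sm \<gamma>0 \<epsilon>(1) unfolding tangent_space_def I_def by force
qed

lemma tangent_space_chart:
  assumes "(C, \<phi>) \<in> A" "p \<in> C"
  shows "tangent_space A p = range (chart_vector C \<phi> p)"
proof
  show "tangent_space A p \<subseteq> range (chart_vector C \<phi> p)"
    using velocity_chart[OF _ _ _ assms(1)] assms(2) by (fastforce simp: tangent_space_def)
  show "range (chart_vector C \<phi> p) \<subseteq> tangent_space A p"
    using chart_vector_in_tangent_space[OF assms] by blast
qed

lemma chart_vector_linear:
  assumes "(C, \<phi>) \<in> A" "p \<in> C"
  shows "chart_vector C \<phi> p (a *\<^sub>R c + b *\<^sub>R d) =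
           (\<lambda>f. a * chart_vector C \<phi> p c f + b * chart_vector C \<phi> p d f)"
proof
  fix f
  show "chart_vector C \<phi> p (a *\<^sub>R c + b *\<^sub>R d) f =
          a * chart_vector C \<phi> p c f + b * chart_vector C \<phi> p d f"
    using linear_frechet_derivative[OF smooth_near_chart_differentiable[OF assms, of f]]
    by (simp add: chart_vector_def linear_add linear_scale)
qed

lemma smooth_fun_coordinate:
  assumes C: "(C, \<phi>) \<in> A"
  shows "smooth_fun A C (\<lambda>q. \<phi> q $ i)"
proof (rule smooth_funI)
  fix C' \<psi> assume C': "(C', \<psi>) \<in> A"
  show "smooth_on (\<psi> ` (C' \<inter> C)) ((\<lambda>q. \<phi> q $ i) \<circ> inv_into C' \<psi>)"
    using smooth_on_bounded_linear[OF bounded_linear_vec_nth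
        open_chart_image[OF C' open_domain[OF C]] smooth_transition[OF C' C], of i]
    by (simp add: comp_def)
qed

lemma chart_vector_coordinate:
  assumes "(C, \<phi>) \<in> A" "p \<in> C"
  shows "chart_vector C \<phi> p c (\<lambda>q. \<phi> q $ i) = c $ i"
proof -
  have "((\<lambda>x. x $ i) has_derivative (\<lambda>x. x $ i)) (at (\<phi> p))"
    using bounded_linear_imp_has_derivative[OF bounded_linear_vec_nth] by blast
  then have "((\<lambda>q. \<phi> q $ i) \<circ> inv_into C \<phi> has_derivative (\<lambda>x. x $ i)) (at (\<phi> p))"
    by (rule has_derivative_transform_within_open[OF _ open_range[OF assms(1)]])
       (use assms chart_inverse in auto)
  then show ?thesis
    using smooth_nearI[OF open_domain[OF assms(1)] assms(2) smooth_fun_coordinate[OF assms(1)]]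
    by (simp add: chart_vector_def frechet_derivative_at[symmetric])
qed

lemma tangent_space_lincomb:
  assumes "u \<in> tangent_space A p" "v \<in> tangent_space A p"
  shows "(\<lambda>f. a * u f + b * v f) \<in> tangent_space A p"
proof -
  obtain C \<phi> where C: "(C, \<phi>) \<in> A" "p \<in> C" by (rule chart_at)
  obtain c d where "u = chart_vector C \<phi> p c" "v = chart_vector C \<phi> p d"
    using assms unfolding tangent_space_chart[OF C] by blast
  then show ?thesis
    using chart_vector_in_tangent_space[OF C, of "a *\<^sub>R c + b *\<^sub>R d"]
    by (simp add: chart_vector_linear[OF C])
qed

lemma zero_tangent: "(\<lambda>f. 0) \<in> tangent_space A p"
proof -
  obtain C \<phi> where C: "(C, \<phi>) \<in> A" "p \<in> C" by (rule chart_at)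
  show ?thesis
    using tangent_space_lincomb[of _ p _ 0 0] chart_vector_in_tangent_space[OF C, of 0] by force
qed

lemma tangent_scale: "u \<in> tangent_space A p \<Longrightarrow> (\<lambda>f. a * u f) \<in> tangent_space A p"
  using tangent_space_lincomb[of u p u a 0] by simp

lemma tangent_add:
  "u \<in> tangent_space A p \<Longrightarrow> v \<in> tangent_space A p \<Longrightarrow> (\<lambda>f. u f + v f) \<in> tangent_space A p"
  using tangent_space_lincomb[of u p v 1 1] by simp

lemma tangent_diff:
  "u \<in> tangent_space A p \<Longrightarrow> v \<in> tangent_space A p \<Longrightarrow> (\<lambda>f. u f - v f) \<in> tangent_space A p"
  using tangent_space_lincomb[of u p v 1 "-1"] by simp

lemma tangent_sum:
  "(\<And>i. i \<in> I \<Longrightarrow> u i \<in> tangent_space A p) \<Longrightarrow>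
   (\<lambda>f. \<Sum>i\<in>I. a i * u i f) \<in> tangent_space A p"
  by (induction I rule: infinite_finite_induct)
     (auto simp: zero_tangent intro!: tangent_add[OF tangent_scale])

text \<open>Being smooth near \<open>p\<close> is itself a property of the germ at \<open>p\<close>, so either both values are
  directional derivatives of the same germ or both are the default value \<open>0\<close>.\<close>

lemma tangent_cong:
  assumes v: "v \<in> tangent_space A p" and V: "open V" "p \<in> V" "\<And>q. q \<in> V \<Longrightarrow> f q = h q"
  shows "v f = v h"
proof -
  obtain C \<phi> where C: "(C, \<phi>) \<in> A" "p \<in> C" by (rule chart_at)
  obtain c where c: "v = chart_vector C \<phi> p c"
    using v unfolding tangent_space_chart[OF C] by blast
  have "frechet_derivative (f \<circ> inv_into C \<phi>) (at (\<phi> p)) =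
        frechet_derivative (h \<circ> inv_into C \<phi>) (at (\<phi> p))"
    by (rule frechet_derivative_cong_open[OF open_chart_image[OF C(1) V(1)]])
       (use C V chart_inverse in auto)
  then show ?thesis
    using smooth_near_cong[OF V] by (simp add: c chart_vector_def)
qed

lemma tangent_const:
  assumes "v \<in> tangent_space A p"
  shows "v (\<lambda>q. c) = 0"
proof -
  obtain C \<phi> where C: "(C, \<phi>) \<in> A" "p \<in> C" by (rule chart_at)
  show ?thesis
    using assms unfolding tangent_space_chart[OF C]
    by (auto simp: chart_vector_def comp_def frechet_derivative_const)
qed

lemma smooth_near_add: "smooth_near A p f \<Longrightarrow> smooth_near A p h \<Longrightarrow> smooth_near A p (\<lambda>q. f q + h q)"
  and smooth_near_mult: "smooth_near A p f \<Longrightarrow> smooth_near A p h \<Longrightarrow> smooth_near A p (\<lambda>q. f q * h q)"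
proof -
  assume "smooth_near A p f" "smooth_near A p h"
  then obtain V W where V: "open V" "p \<in> V" "smooth_fun A V f" and W: "open W" "p \<in> W" "smooth_fun A W h"
    unfolding smooth_near_def by blast
  have o: "open (V \<inter> W)" "p \<in> V \<inter> W" using V W by auto
  have f: "smooth_fun A (V \<inter> W) f" and h: "smooth_fun A (V \<inter> W) h"
    using smooth_fun_mono V(3) W(3) by auto
  show "smooth_near A p (\<lambda>q. f q + h q)" "smooth_near A p (\<lambda>q. f q * h q)"
    using smooth_nearI[OF o] smooth_fun_add[OF o(1) f h] smooth_fun_mult[OF o(1) f h] by auto
qed

lemma tangent_of_add:
  assumes v: "v \<in> tangent_space A p" and f: "smooth_near A p f" and h: "smooth_near A p h"
  shows "v (\<lambda>q. f q + h q) = v f + v h"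
proof -
  obtain C \<phi> where C: "(C, \<phi>) \<in> A" "p \<in> C" by (rule chart_at)
  obtain c where c: "v = chart_vector C \<phi> p c"
    using v unfolding tangent_space_chart[OF C] by blast
  show ?thesis
    using frechet_derivative_add[OF smooth_near_chart_differentiable[OF C f]
        smooth_near_chart_differentiable[OF C h], of c]
    by (simp add: c chart_vector_def f h smooth_near_add comp_def)
qed

lemma tangent_of_mult:
  assumes v: "v \<in> tangent_space A p" and f: "smooth_near A p f" and h: "smooth_near A p h"
  shows "v (\<lambda>q. f q * h q) = f p * v h + v f * h p"
proof -
  obtain C \<phi> where C: "(C, \<phi>) \<in> A" "p \<in> C" by (rule chart_at)
  obtain c where c: "v = chart_vector C \<phi> p c"
    using v unfolding tangent_space_chart[OF C] by blast
  show ?thesis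
    using frechet_derivative_mult_real[OF smooth_near_chart_differentiable[OF C f]
        smooth_near_chart_differentiable[OF C h], of c]
    by (simp add: c chart_vector_def f h smooth_near_mult comp_def chart_inverse[OF C])
qed

lemma tangent_of_scale:
  assumes v: "v \<in> tangent_space A p" and f: "smooth_near A p f"
  shows "v (\<lambda>q. c * f q) = c * v f"
  using tangent_of_mult[OF v smooth_nearI[OF open_UNIV UNIV_I smooth_fun_const] f, of c]
    tangent_const[OF v] by simp

lemma tangent_of_diff:
  assumes v: "v \<in> tangent_space A p" and f: "smooth_near A p f" and h: "smooth_near A p h"
  shows "v (\<lambda>q. f q - h q) = v f - v h"
  using tangent_of_add[OF v f smooth_near_mult[OF smooth_nearI[OF open_UNIV UNIV_I smooth_fun_const] h], of "-1"]
    tangent_of_scale[OF v h, of "-1"] by simp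

section \<open>Smooth vector fields\<close>

lemma vfield_tangent: "smooth_vfield A V X \<Longrightarrow> p \<in> V \<Longrightarrow> X p \<in> tangent_space A p"
  unfolding smooth_vfield_def by blast

lemma vfield_smooth_fun:
  "smooth_vfield A V X \<Longrightarrow> open W \<Longrightarrow> W \<subseteq> V \<Longrightarrow> smooth_fun A W f \<Longrightarrow> smooth_fun A W (\<lambda>p. X p f)"
  unfolding smooth_vfield_def by blast

lemma smooth_vfield_mono: "smooth_vfield A V X \<Longrightarrow> W \<subseteq> V \<Longrightarrow> smooth_vfield A W X"
  unfolding smooth_vfield_def by (meson subset_eq subset_trans)

lemma smooth_vfield_cong:
  assumes "\<And>q. q \<in> V \<Longrightarrow> X q = Y q" "smooth_vfield A V X"
  shows "smooth_vfield A V Y"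
  unfolding smooth_vfield_def
proof (intro conjI ballI allI impI)
  fix p assume "p \<in> V" then show "Y p \<in> tangent_space A p"
    using assms vfield_tangent by metis
next
  fix W f assume W: "open W \<and> W \<subseteq> V \<and> smooth_fun A W f"
  have "smooth_fun A W (\<lambda>p. X p f)"
    using vfield_smooth_fun[OF assms(2)] W by blast
  moreover have "X p f = Y p f" if "p \<in> W" for p
    using assms(1)[of p] W that by auto
  ultimately show "smooth_fun A W (\<lambda>p. Y p f)"
    using smooth_fun_cong[of W "\<lambda>p. X p f" "\<lambda>p. Y p f"] W by blast
qed

lemma smooth_vfield_zero: "smooth_vfield A V (\<lambda>q f. 0)"
  unfolding smooth_vfield_def by (auto simp: zero_tangent smooth_fun_const)

lemma smooth_vfield_scale:
  assumes "smooth_fun A V h" "smooth_vfield A V X"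
  shows "smooth_vfield A V (\<lambda>q f. h q * X q f)"
  unfolding smooth_vfield_def
  using tangent_scale[OF vfield_tangent[OF assms(2)]]
    smooth_fun_mult[OF _ smooth_fun_mono[OF assms(1)] vfield_smooth_fun[OF assms(2)]] by auto

lemma smooth_vfield_add:
  assumes "smooth_vfield A V X" "smooth_vfield A V Y"
  shows "smooth_vfield A V (\<lambda>q f. X q f + Y q f)"
  unfolding smooth_vfield_def
  using tangent_add[OF vfield_tangent[OF assms(1)] vfield_tangent[OF assms(2)]]
    smooth_fun_add[OF _ vfield_smooth_fun[OF assms(1)] vfield_smooth_fun[OF assms(2)]] by auto

lemma smooth_vfield_diff:
  assumes "smooth_vfield A V X" "smooth_vfield A V Y"
  shows "smooth_vfield A V (\<lambda>q f. X q f - Y q f)"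
  unfolding smooth_vfield_def
  using tangent_diff[OF vfield_tangent[OF assms(1)] vfield_tangent[OF assms(2)]]
    smooth_fun_diff[OF _ vfield_smooth_fun[OF assms(1)] vfield_smooth_fun[OF assms(2)]] by auto

lemma smooth_vfield_sum:
  assumes "\<And>i. i \<in> I \<Longrightarrow> smooth_fun A V (h i)" "\<And>i. i \<in> I \<Longrightarrow> smooth_vfield A V (X i)"
  shows "smooth_vfield A V (\<lambda>q f. \<Sum>i\<in>I. h i q * X i q f)"
  using assms
  by (induction I rule: infinite_finite_induct)
     (auto simp: smooth_vfield_zero intro!: smooth_vfield_add smooth_vfield_scale)

lemma smooth_vfield_chart:
  assumes C: "(C, \<phi>) \<in> A"
  shows "smooth_vfield A C (\<lambda>q. chart_vector C \<phi> q c)"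
  unfolding smooth_vfield_def
proof (intro conjI ballI allI impI)
  fix p assume "p \<in> C"
  then show "chart_vector C \<phi> p c \<in> tangent_space A p"
    by (rule chart_vector_in_tangent_space[OF C])
next
  fix W f assume "open W \<and> W \<subseteq> C \<and> smooth_fun A W f"
  then have W: "open W" "W \<subseteq> C" and f: "smooth_fun A W f" by auto
  have CW: "C \<inter> W = W" using W by auto
  have o: "open (\<phi> ` W)" using open_chart_image[OF C W(1)] by (simp add: CW)
  have "smooth_on (\<phi> ` W) (\<lambda>x. frechet_derivative (f \<circ> inv_into C \<phi>) (at x) c)"
    using smooth_on_frechet_derivative[OF smooth_funD[OF f C]] by (simp add: CW)
  moreover have "((\<lambda>q. chart_vector C \<phi> q c f) \<circ> inv_into C \<phi>) x =
                   frechet_derivative (f \<circ> inv_into C \<phi>) (at x) c" if "x \<in> \<phi> ` W" for x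
    using that W smooth_nearI[OF W(1) _ f] chart_inverse[OF C]
    by (auto simp: chart_vector_def)
  ultimately have "smooth_on (\<phi> ` W) ((\<lambda>q. chart_vector C \<phi> q c f) \<circ> inv_into C \<phi>)"
    using smooth_on_cong[OF o, of "(\<lambda>q. chart_vector C \<phi> q c f) \<circ> inv_into C \<phi>"
        "\<lambda>x. frechet_derivative (f \<circ> inv_into C \<phi>) (at x) c"] by simp
  then show "smooth_fun A W (\<lambda>q. chart_vector C \<phi> q c f)"
    by (rule smooth_fun_chartI[OF C W])
qed

lemma lie_bracket_apply:
  "smooth_near A p f \<Longrightarrow> lie_bracket A X Y p f = X p (\<lambda>q. Y q f) - Y p (\<lambda>q. X q f)"
  by (simp add: lie_bracket_def)

lemma lie_bracket_flip: "lie_bracket A Y X p f = - lie_bracket A X Y p f"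
  by (simp add: lie_bracket_def)

text \<open>The bracket of \<open>Y\<close> and \<open>Z\<close> is a commutator only on functions that are smooth near
  the point in question. It is differentiated here, so this has to hold on a neighbourhood of \<open>p\<close>, and
  then \<open>X p\<close> does not see the difference.\<close>

lemma lie_bracket_bracket_apply:
  assumes V: "open V" "p \<in> V" and X: "smooth_vfield A V X" and Y: "smooth_vfield A V Y"
    and Z: "smooth_vfield A V Z" and f: "smooth_fun A W f" "open W" "p \<in> W" "W \<subseteq> V"
  shows "lie_bracket A X (lie_bracket A Y Z) p f =
           X p (\<lambda>q. Y q (\<lambda>r. Z r f)) - X p (\<lambda>q. Z q (\<lambda>r. Y r f))
           - (Y p (\<lambda>q. Z q (\<lambda>r. X r f)) - Z p (\<lambda>q. Y q (\<lambda>r. X r f)))"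
proof -
  note sm = vfield_smooth_fun[OF _ f(2,4)] and near = smooth_nearI[OF f(2,3)]
  have "X p (\<lambda>q. lie_bracket A Y Z q f) = X p (\<lambda>q. Y q (\<lambda>r. Z r f) - Z q (\<lambda>r. Y r f))"
    using f smooth_nearI lie_bracket_apply
    by (intro tangent_cong[OF vfield_tangent[OF X V(2)] f(2,3)]) blast
  also have "\<dots> = X p (\<lambda>q. Y q (\<lambda>r. Z r f)) - X p (\<lambda>q. Z q (\<lambda>r. Y r f))"
    by (rule tangent_of_diff[OF vfield_tangent[OF X V(2)]])
       (intro near sm[OF Y] sm[OF Z] f)+
  finally show ?thesis
    using near[OF f(1)] near[OF sm[OF X f(1)]] by (simp add: lie_bracket_apply)
qed

lemma lie_bracket_jacobi:
  assumes V: "open V" "p \<in> V" and X: "smooth_vfield A V X" and Y: "smooth_vfield A V Y"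
    and Z: "smooth_vfield A V Z"
  shows "lie_bracket A X (lie_bracket A Y Z) p f + lie_bracket A Y (lie_bracket A Z X) p f
         + lie_bracket A Z (lie_bracket A X Y) p f = 0"
proof (cases "smooth_near A p f")
  case True
  then obtain W where W: "open W" "p \<in> W" "smooth_fun A W f"
    unfolding smooth_near_def by blast
  have W': "smooth_fun A (V \<inter> W) f" "open (V \<inter> W)" "p \<in> V \<inter> W" "V \<inter> W \<subseteq> V"
    using W V smooth_fun_mono[OF W(3), of "V \<inter> W"] by auto
  show ?thesis
    by (simp add: lie_bracket_bracket_apply[OF V X Y Z W'] lie_bracket_bracket_apply[OF V Y Z X W']
        lie_bracket_bracket_apply[OF V Z X Y W'])
qed (simp add: lie_bracket_def)

end

section \<open>Orthonormal frames\<close>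

context riemannian_manifold
begin

lemma metric_scale_left:
  "u \<in> tangent_space A p \<Longrightarrow> w \<in> tangent_space A p \<Longrightarrow> g p (\<lambda>f. a * u f) w = a * g p u w"
  using metric_linear[of u p u w a 0] by simp

lemma metric_add_left:
  "u \<in> tangent_space A p \<Longrightarrow> v \<in> tangent_space A p \<Longrightarrow> w \<in> tangent_space A p \<Longrightarrow>
   g p (\<lambda>f. u f + v f) w = g p u w + g p v w"
  using metric_linear[of u p v w 1 1] by simp

lemma metric_diff_left:
  "u \<in> tangent_space A p \<Longrightarrow> v \<in> tangent_space A p \<Longrightarrow> w \<in> tangent_space A p \<Longrightarrow>
   g p (\<lambda>f. u f - v f) w = g p u w - g p v w"
  using metric_linear[of u p v w 1 "-1"] by simp

lemma metric_zero_left: "w \<in> tangent_space A p \<Longrightarrow> g p (\<lambda>f. 0) w = 0"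
  using metric_scale_left[OF zero_tangent, of w p 0] by simp

lemma metric_sum_left:
  assumes "\<And>i. i \<in> I \<Longrightarrow> u i \<in> tangent_space A p" "w \<in> tangent_space A p"
  shows "g p (\<lambda>f. \<Sum>i\<in>I. a i * u i f) w = (\<Sum>i\<in>I. a i * g p (u i) w)"
  using assms(1)
  by (induction I rule: infinite_finite_induct)
     (simp_all add: metric_zero_left assms(2) metric_add_left metric_scale_left tangent_scale tangent_sum)

lemma metric_scale_right:
  "u \<in> tangent_space A p \<Longrightarrow> w \<in> tangent_space A p \<Longrightarrow> g p w (\<lambda>f. a * u f) = a * g p w u"
  using metric_scale_left[of u p w a] metric_sym[of u p w] metric_sym[OF _ tangent_scale, of w p u a]
  by simp

lemma metric_add_right:
  "u \<in> tangent_space A p \<Longrightarrow> v \<in> tangent_space A p \<Longrightarrow> w \<in> tangent_space A p \<Longrightarrow>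
   g p w (\<lambda>f. u f + v f) = g p w u + g p w v"
  using metric_add_left[of u p v w] metric_sym[of u p w] metric_sym[of v p w]
    metric_sym[OF _ tangent_add, of w p u v] by simp

lemma metric_definite:
  "u \<in> tangent_space A p \<Longrightarrow> g p u u = 0 \<Longrightarrow> u = (\<lambda>f. 0)"
  using metric_pos[of u p] by fastforce

text \<open>A partial frame, indexed by a subset of \<open>'n\<close>, which can be enlarged one index at a time. This
  allows a frame to start from a prescribed unit field.\<close>

definition orthonormal_on :: "'a set \<Rightarrow> 'n set \<Rightarrow> ('n \<Rightarrow> 'a vfield) \<Rightarrow> bool" where
  "orthonormal_on W J E \<longleftrightarrow>
     (\<forall>i\<in>J. smooth_vfield A W (E i)) \<and>
     (\<forall>q\<in>W. \<forall>i\<in>J. \<forall>j\<in>J. g q (E i q) (E j q) = (if i = j then 1 else 0))"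

lemma orthonormal_coefficient:
  assumes "orthonormal_on W J E" "q \<in> W" "j \<in> J" "finite J"
  shows "g q (\<lambda>f. \<Sum>i\<in>J. c i * E i q f) (E j q) = c j"
proof -
  have E: "E i q \<in> tangent_space A q" if "i \<in> J" for i
    using assms(1,2) that vfield_tangent unfolding orthonormal_on_def by blast
  have "g q (\<lambda>f. \<Sum>i\<in>J. c i * E i q f) (E j q) = (\<Sum>i\<in>J. c i * g q (E i q) (E j q))"
    by (rule metric_sum_left) (use E assms(3) in auto)
  also have "\<dots> = (\<Sum>i\<in>J. if i = j then c i else 0)"
    using assms(1-3) unfolding orthonormal_on_def by (intro sum.cong) auto
  finally show ?thesis using assms(3,4) by simp
qed

lemma chart_vector_sum:
  assumes "(C, \<phi>) \<in> A" "p \<in> C"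
  shows "chart_vector C \<phi> p (\<Sum>i\<in>I. c i *\<^sub>R d i) = (\<lambda>f. \<Sum>i\<in>I. c i * chart_vector C \<phi> p (d i) f)"
proof (induction I rule: infinite_finite_induct)
  case (insert i I)
  then show ?case
    using chart_vector_linear[OF assms, of "c i" "d i" 1 "\<Sum>i\<in>I. c i *\<^sub>R d i"] by simp
qed (use chart_vector_linear[OF assms, of 0 0 0 0] in simp_all)

lemma chart_vector_eq_iff:
  assumes "(C, \<phi>) \<in> A" "p \<in> C"
  shows "chart_vector C \<phi> p c = chart_vector C \<phi> p d \<longleftrightarrow> c = d"
  using chart_vector_coordinate[OF assms] by (metis vec_eq_iff)

text \<open>The coefficients with respect to orthonormal fields indexed by \<open>'n\<close> are determined by the
  metric, so the map from coefficients to tangent vectors is injective; between spaces of equal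
  finite dimension it is then surjective.\<close>

lemma orthonormal_on_UNIV_frame:
  assumes E: "orthonormal_on W UNIV E"
  shows "orthonormal_frame A g W E"
proof -
  have "\<exists>!c. v = (\<lambda>f. \<Sum>i\<in>UNIV. c i * E i q f)" if q: "q \<in> W" and v: "v \<in> tangent_space A q" for q v
  proof -
    obtain C \<phi> where C: "(C, \<phi>) \<in> A" "q \<in> C" by (rule chart_at)
    have "\<forall>i. \<exists>d. E i q = chart_vector C \<phi> q d"
      using E vfield_tangent[OF _ q] tangent_space_chart[OF C] unfolding orthonormal_on_def by blast
    then obtain d where d: "\<And>i. E i q = chart_vector C \<phi> q (d i)" by metis
    define F where "F c = (\<Sum>i\<in>UNIV. (c $ i) *\<^sub>R d i)" for c :: "real ^ 'n"
    have F: "chart_vector C \<phi> q (F c) = (\<lambda>f. \<Sum>i\<in>UNIV. c $ i * E i q f)" for c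
      unfolding F_def d by (rule chart_vector_sum[OF C])
    have coeff: "g q (\<lambda>f. \<Sum>i\<in>UNIV. c i * E i q f) (E j q) = c j" for c j
      by (rule orthonormal_coefficient[OF E q]) auto
    have "linear F"
      by (rule linearI) (simp_all add: F_def scaleR_add_left sum.distrib scaleR_sum_right)
    moreover have "inj F"
    proof (rule injI)
      fix b c assume "F b = F c"
      then have "(\<lambda>f. \<Sum>i\<in>UNIV. b $ i * E i q f) = (\<lambda>f. \<Sum>i\<in>UNIV. c $ i * E i q f)"
        using F by metis
      then have "b $ j = c $ j" for j
        using coeff[of "\<lambda>i. b $ i" j] coeff[of "\<lambda>i. c $ i" j] by simp
      then show "b = c" by (simp add: vec_eq_iff)
    qed
    ultimately have "surj F" by (rule linear_injective_imp_surjective) simp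
    obtain e where "v = chart_vector C \<phi> q e"
      using v unfolding tangent_space_chart[OF C] by blast
    moreover obtain c where "e = F c" using \<open>surj F\<close> by (rule surjE)
    ultimately have c: "v = (\<lambda>f. \<Sum>i\<in>UNIV. c $ i * E i q f)" using F by simp
    show ?thesis
    proof (rule ex1I)
      show "v = (\<lambda>f. \<Sum>i\<in>UNIV. (\<lambda>i. c $ i) i * E i q f)" using c by simp
    next
      fix b assume "v = (\<lambda>f. \<Sum>i\<in>UNIV. b i * E i q f)"
      then show "b = (\<lambda>i. c $ i)"
        using coeff[of b] coeff[of "\<lambda>i. c $ i"] c by (intro ext) metis
    qed
  qed
  then show ?thesis
    using E unfolding orthonormal_frame_def local_frame_def orthonormal_on_def by blast
qed

text \<open>Gram--Schmidt: fewer than \<open>CARD('n)\<close> fields do not span the tangent space at \<open>p\<close>, so some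
  coordinate field has a nonzero component orthogonal to them, which stays nonzero near \<open>p\<close>.\<close>

lemma orthonormal_on_extend:
  assumes W: "open W" "p \<in> W" and E: "orthonormal_on W J E" and i: "i \<notin> J"
  obtains W' E' where "open W'" "p \<in> W'" "W' \<subseteq> W" "orthonormal_on W' (insert i J) E'"
    "\<And>j. j \<in> J \<Longrightarrow> E' j = E j"
proof -
  obtain C \<phi> where C: "(C, \<phi>) \<in> A" "p \<in> C" by (rule chart_at)
  define e :: "'n \<Rightarrow> 'a vfield" where "e j = (\<lambda>q. chart_vector C \<phi> q (axis j 1))" for j
  define Y :: "'n \<Rightarrow> 'a vfield"
    where "Y j = (\<lambda>q f. e j q f - (\<Sum>l\<in>J. g q (e j q) (E l q) * E l q f))" for j
  let ?W = "W \<inter> C"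
  have oW: "open ?W" "p \<in> ?W" using W C open_domain by auto
  have Es: "smooth_vfield A ?W (E l)" if "l \<in> J" for l
    using E that smooth_vfield_mono[of W "E l" ?W] unfolding orthonormal_on_def by blast
  have es: "smooth_vfield A ?W (e j)" for j
    unfolding e_def by (rule smooth_vfield_mono[OF smooth_vfield_chart[OF C(1)]]) blast
  have Ys: "smooth_vfield A ?W (Y j)" for j
    unfolding Y_def by (intro smooth_vfield_diff smooth_vfield_sum es metric_smooth oW Es)
  \<comment> \<open>Otherwise the fields \<open>E l\<close>, \<open>l \<in> J\<close>, would span the whole coordinate space at \<open>p\<close>.\<close>
  have "\<exists>j. Y j p \<noteq> (\<lambda>f. 0)"
  proof (rule ccontr)
    assume "\<not> ?thesis"
    then have Y0: "Y j p = (\<lambda>f. 0)" for j by blast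
    have "\<forall>l\<in>J. \<exists>d. E l p = chart_vector C \<phi> p d"
      using Es vfield_tangent[OF _ oW(2)] tangent_space_chart[OF C] by blast
    then obtain d where d: "\<And>l. l \<in> J \<Longrightarrow> E l p = chart_vector C \<phi> p (d l)" by metis
    have "axis j 1 \<in> span (d ` J)" for j
    proof -
      have "chart_vector C \<phi> p (axis j 1) = (\<lambda>f. \<Sum>l\<in>J. g p (e j p) (E l p) * E l p f)"
        using fun_cong[OF Y0[of j]] by (intro ext) (simp add: Y_def e_def)
      also have "\<dots> = chart_vector C \<phi> p (\<Sum>l\<in>J. g p (e j p) (E l p) *\<^sub>R d l)"
        unfolding chart_vector_sum[OF C] by (intro ext sum.cong) (simp_all add: d)
      finally show ?thesis
        unfolding chart_vector_eq_iff[OF C] by (simp add: span_sum span_scale span_base)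
    qed
    then have "x \<in> span (d ` J)" for x :: "real ^ 'n"
      using basis_expansion[of x] by (metis (no_types, lifting) span_sum span_scale scalar_mult_eq_scaleR)
    then have "dim (UNIV :: (real ^ 'n) set) \<le> card (d ` J)"
      by (intro dim_le_card) auto
    also have "\<dots> \<le> card J" by (rule card_image_le) simp
    also have "\<dots> < CARD('n)" using i by (intro psubset_card_mono) auto
    finally show False by simp
  qed
  then obtain j where j: "Y j p \<noteq> (\<lambda>f. 0)" by blast
  define Z where "Z = Y j"
  have Zs: "smooth_vfield A ?W Z" using Ys Z_def by simp
  have sm: "smooth_fun A ?W (\<lambda>q. g q (Z q) (Z q))"
    by (rule metric_smooth[OF oW(1) Zs Zs])
  define W' where "W' = {q \<in> ?W. 0 < g q (Z q) (Z q)}"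
  have "open W'"
    using continuous_open_preimage[OF smooth_fun_continuous_on[OF oW(1) sm] oW(1) open_greaterThan[of 0]]
    by (simp add: W'_def vimage_def Collect_conj_eq Int_assoc)
  moreover have "p \<in> W'"
    using metric_pos[OF vfield_tangent[OF Zs oW(2)]] j oW(2) by (simp add: W'_def Z_def)
  moreover have sub: "W' \<subseteq> ?W" by (auto simp: W'_def)
  define r where "r q = g q (Z q) (Z q) powr (-1/2)" for q
  define E' where "E' = E(i := \<lambda>q f. r q * Z q f)"
  have E'j: "E' l = E l" if "l \<in> J" for l
    using that i by (auto simp: E'_def)
  have E'i: "E' i = (\<lambda>q f. r q * Z q f)" by (simp add: E'_def)
  have rs: "smooth_fun A W' r"
    unfolding r_def
    by (rule smooth_fun_powr[OF \<open>open W'\<close> smooth_fun_mono[OF sm sub]]) (simp add: W'_def)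
  have smE': "smooth_vfield A W' (E' l)" if "l \<in> insert i J" for l
    using that smooth_vfield_scale[OF rs smooth_vfield_mono[OF Zs sub]]
      smooth_vfield_mono[OF Es sub] by (auto simp: E'i E'j)
  have rn: "r q * (r q * g q (Z q) (Z q)) = 1" if "q \<in> W'" for q
  proof -
    have "g q (Z q) (Z q) > 0" using that by (simp add: W'_def)
    then show ?thesis
      by (simp add: r_def powr_add[symmetric] powr_minus field_simps flip: mult.assoc)
  qed
  have orth: "g q (Z q) (E l q) = 0" if q: "q \<in> W'" and l: "l \<in> J" for q l
  proof -
    have T: "e j q \<in> tangent_space A q" "\<And>m. m \<in> J \<Longrightarrow> E m q \<in> tangent_space A q"
      using es Es vfield_tangent sub q by blast+
    have "g q (\<lambda>f. \<Sum>m\<in>J. g q (e j q) (E m q) * E m q f) (E l q) = g q (e j q) (E l q)"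
      by (rule orthonormal_coefficient[OF E _ l]) (use q sub in auto)
    then show ?thesis
      unfolding Z_def Y_def using T l by (simp add: metric_diff_left tangent_sum)
  qed
  have "g q (E' l q) (E' m q) = (if l = m then 1 else 0)"
    if q: "q \<in> W'" and lm: "l \<in> insert i J" "m \<in> insert i J" for q l m
  proof -
    have Z: "Z q \<in> tangent_space A q" using vfield_tangent[OF Zs] sub q by blast
    have T: "E m q \<in> tangent_space A q" if "m \<in> J" for m
      using vfield_tangent[OF Es[OF that]] sub q by blast
    consider "l \<in> J" "m \<in> J" | "l = i" "m \<in> J" | "l \<in> J" "m = i" | "l = i" "m = i"
      using lm by blast
    then show ?thesis
    proof cases
      case 1
      then show ?thesis using E q sub by (auto simp: E'j orthonormal_on_def)
    next
      case 2
      then show ?thesis using i orth[OF q] Z T by (auto simp: E'i E'j metric_scale_left)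
    next
      case 3
      then show ?thesis
        using i orth[OF q] Z T metric_sym[OF T Z, of l] by (auto simp: E'i E'j metric_scale_right)
    next
      case 4
      then show ?thesis
        using rn[OF q] Z by (simp add: E'i metric_scale_left metric_scale_right tangent_scale)
    qed
  qed
  then have "orthonormal_on W' (insert i J) E'"
    using smE' unfolding orthonormal_on_def by blast
  ultimately show thesis
    using that[of W' E'] E'j sub by blast
qed

lemma orthonormal_on_extend_frame:
  assumes "open W" "p \<in> W" "orthonormal_on W J E"
  obtains W' E' where "open W'" "p \<in> W'" "W' \<subseteq> W" "orthonormal_frame A g W' E'"
    "\<And>j. j \<in> J \<Longrightarrow> E' j = E j"
proof -
  have "\<exists>W' E'. open W' \<and> p \<in> W' \<and> W' \<subseteq> W \<and> orthonormal_on W' (K \<union> J) E' \<and> (\<forall>j\<in>J. E' j = E j)"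
    if "K \<inter> J = {}" for K
    using finite[of K] that
  proof (induction K rule: finite_induct)
    case empty
    then show ?case using assms by auto
  next
    case (insert i K)
    then obtain W1 E1 where W1: "open W1" "p \<in> W1" "W1 \<subseteq> W" "orthonormal_on W1 (K \<union> J) E1"
      and E1: "\<forall>j\<in>J. E1 j = E j" by auto
    have "i \<notin> K \<union> J" using insert by auto
    from orthonormal_on_extend[OF W1(1,2,4) this] obtain W2 E2 where
      "open W2" "p \<in> W2" "W2 \<subseteq> W1" "orthonormal_on W2 (insert i (K \<union> J)) E2"
      "\<And>j. j \<in> K \<union> J \<Longrightarrow> E2 j = E1 j" by blast
    then show ?case
      using W1(3) E1 by (intro exI[of _ W2] exI[of _ E2]) auto
  qed
  from this[of "- J"] obtain W' E' where
    "open W'" "p \<in> W'" "W' \<subseteq> W" "orthonormal_on W' UNIV E'" "\<forall>j\<in>J. E' j = E j"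
    by (auto simp: Compl_partition2)
  then show thesis using that orthonormal_on_UNIV_frame by blast
qed

lemma frame_near:
  obtains W where "open W" "p \<in> W" "orthonormal_frame A g W (frame_near A g p)"
proof -
  have "orthonormal_on UNIV {} E" for E by (simp add: orthonormal_on_def)
  from orthonormal_on_extend_frame[OF open_UNIV UNIV_I this]
  have "\<exists>E W. open W \<and> p \<in> W \<and> orthonormal_frame A g W E" by metis
  then have "\<exists>W. open W \<and> p \<in> W \<and> orthonormal_frame A g W (frame_near A g p)"
    unfolding frame_near_def by (rule someI_ex)
  then show thesis using that by blast
qed

lemma orthonormal_frame_vfield: "orthonormal_frame A g W E \<Longrightarrow> smooth_vfield A W (E i)"
  unfolding orthonormal_frame_def local_frame_def by blast

lemma orthonormal_frame_metric:
  "orthonormal_frame A g W E \<Longrightarrow> q \<in> W \<Longrightarrow> g q (E i q) (E j q) = (if i = j then 1 else 0)"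
  unfolding orthonormal_frame_def by blast

lemma orthonormal_frame_mono: "orthonormal_frame A g W E \<Longrightarrow> W' \<subseteq> W \<Longrightarrow> orthonormal_frame A g W' E"
  unfolding orthonormal_frame_def local_frame_def using smooth_vfield_mono by blast

lemma orthonormal_frame_expand:
  assumes E: "orthonormal_frame A g W E" and q: "q \<in> W" and v: "v \<in> tangent_space A q"
  shows "v = (\<lambda>f. \<Sum>i\<in>UNIV. g q v (E i q) * E i q f)"
proof -
  obtain c where c: "v = (\<lambda>f. \<Sum>i\<in>UNIV. c i * E i q f)"
    using E q v unfolding orthonormal_frame_def local_frame_def by blast
  have "orthonormal_on W UNIV E"
    using E unfolding orthonormal_frame_def local_frame_def orthonormal_on_def by blast
  from orthonormal_coefficient[OF this q] have "g q v (E j q) = c j" for j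
    unfolding c by simp
  then show ?thesis using c by simp
qed

text \<open>Expressions such as the curvature are formed from fields by differentiation, yet depend on
  the values at one point only. What makes this so is linearity over functions, stated here for one
  argument, at the one point \<open>p\<close>.\<close>

definition tensorial_at :: "'a set \<Rightarrow> 'a \<Rightarrow> ('a vfield \<Rightarrow> real) \<Rightarrow> bool" where
  "tensorial_at W p B \<longleftrightarrow>
     (\<forall>h X Y. smooth_fun A W h \<and> smooth_vfield A W X \<and> smooth_vfield A W Y \<longrightarrow>
        B (\<lambda>q f. h q * X q f + Y q f) = h p * B X + B Y) \<and>
     (\<forall>X Y. smooth_vfield A W X \<and> smooth_vfield A W Y \<and> (\<forall>q\<in>W. X q = Y q) \<longrightarrow> B X = B Y)"

lemma tensorial_atI:
  assumes "\<And>h X Y. smooth_fun A W h \<Longrightarrow> smooth_vfield A W X \<Longrightarrow> smooth_vfield A W Y \<Longrightarrow>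
             B (\<lambda>q f. h q * X q f + Y q f) = h p * B X + B Y"
    and "\<And>X Y. smooth_vfield A W X \<Longrightarrow> smooth_vfield A W Y \<Longrightarrow> (\<And>q. q \<in> W \<Longrightarrow> X q = Y q) \<Longrightarrow> B X = B Y"
  shows "tensorial_at W p B"
  using assms unfolding tensorial_at_def by blast

lemma tensorial_at_expand:
  assumes B: "tensorial_at W p B" and E: "orthonormal_frame A g W E" and W: "open W" "p \<in> W"
    and X: "smooth_vfield A W X"
  shows "B X = (\<Sum>i\<in>UNIV. g p (X p) (E i p) * B (E i))"
proof -
  let ?h = "\<lambda>i q. g q (X q) (E i q)"
  have lin: "B (\<lambda>q f. h q * X q f + Y q f) = h p * B X + B Y"
    if "smooth_fun A W h" "smooth_vfield A W X" "smooth_vfield A W Y" for h X Y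
    using B that unfolding tensorial_at_def by blast
  have cong: "B X = B Y"
    if "smooth_vfield A W X" "smooth_vfield A W Y" "\<And>q. q \<in> W \<Longrightarrow> X q = Y q" for X Y
    using B that unfolding tensorial_at_def by blast
  have Es: "smooth_vfield A W (E i)" for i by (rule orthonormal_frame_vfield[OF E])
  have hs: "smooth_fun A W (?h i)" for i by (rule metric_smooth[OF W(1) X Es])
  have zero: "B (\<lambda>q f. 0) = 0"
    using lin[OF smooth_fun_const[of W 1] smooth_vfield_zero smooth_vfield_zero] by simp
  have "B (\<lambda>q f. \<Sum>i\<in>I. ?h i q * E i q f) = (\<Sum>i\<in>I. ?h i p * B (E i))" for I
    using finite[of I]
    by (induction I rule: finite_induct) (simp_all add: zero lin hs Es smooth_vfield_sum)
  moreover have "B X = B (\<lambda>q f. \<Sum>i\<in>UNIV. ?h i q * E i q f)"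
  proof (rule cong[OF X])
    show "smooth_vfield A W (\<lambda>q f. \<Sum>i\<in>UNIV. ?h i q * E i q f)"
      by (rule smooth_vfield_sum) (rule hs Es)+
    show "X q = (\<lambda>f. \<Sum>i\<in>UNIV. ?h i q * E i q f)" if "q \<in> W" for q
      by (rule orthonormal_frame_expand[OF E that vfield_tangent[OF X that]])
  qed
  ultimately show ?thesis by simp
qed

text \<open>Expanding the first argument in \<open>F\<close> and then, for each \<open>F a\<close>, recombining the second in
  \<open>E\<close> turns one trace into the other.\<close>

lemma trace_frame_independent:
  assumes B1: "\<And>Y. smooth_vfield A W Y \<Longrightarrow> tensorial_at W p (\<lambda>X. B X Y)"
    and B2: "\<And>X. smooth_vfield A W X \<Longrightarrow> tensorial_at W p (B X)"
    and E: "orthonormal_frame A g W E" and F: "orthonormal_frame A g W F" and W: "open W" "p \<in> W"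
  shows "(\<Sum>i\<in>UNIV. B (E i) (E i)) = (\<Sum>a\<in>UNIV. B (F a) (F a))"
proof -
  note Es = orthonormal_frame_vfield[OF E] and Fs = orthonormal_frame_vfield[OF F]
  have "B (E i) (E i) = (\<Sum>a\<in>UNIV. g p (E i p) (F a p) * B (F a) (E i))" for i
    by (rule tensorial_at_expand[OF B1[OF Es] F W Es])
  then have "(\<Sum>i\<in>UNIV. B (E i) (E i)) =
             (\<Sum>i\<in>UNIV. \<Sum>a\<in>UNIV. g p (E i p) (F a p) * B (F a) (E i))"
    by simp
  also have "\<dots> = (\<Sum>a\<in>UNIV. \<Sum>i\<in>UNIV. g p (E i p) (F a p) * B (F a) (E i))"
    by (rule sum.swap)
  also have "\<dots> = (\<Sum>a\<in>UNIV. \<Sum>i\<in>UNIV. g p (F a p) (E i p) * B (F a) (E i))"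
    using metric_sym[OF vfield_tangent[OF Es W(2)] vfield_tangent[OF Fs W(2)]] by simp
  also have "\<dots> = (\<Sum>a\<in>UNIV. B (F a) (F a))"
    using tensorial_at_expand[OF B2[OF Fs] E W Fs] by simp
  finally show ?thesis .
qed

end

section \<open>Curvature\<close>

context levi_civita_connection
begin

lemma nabla_smooth:
  "open V \<Longrightarrow> smooth_vfield A V X \<Longrightarrow> smooth_vfield A V Y \<Longrightarrow> smooth_vfield A V (nabla D X Y)"
  unfolding nabla_def by (rule smooth)

lemma nabla_tangent:
  "open V \<Longrightarrow> smooth_vfield A V X \<Longrightarrow> smooth_vfield A V Y \<Longrightarrow> p \<in> V \<Longrightarrow>
   D p (X p) Y \<in> tangent_space A p"
  using vfield_tangent[OF smooth] by blast

lemma D_lincomb: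
  assumes "open V" "p \<in> V" "smooth_fun A V h" "smooth_vfield A V Y" "smooth_vfield A V Z"
    "v \<in> tangent_space A p"
  shows "D p v (\<lambda>q f. h q * Y q f + Z q f) = (\<lambda>f. v h * Y p f + h p * D p v Y f + D p v Z f)"
  using additive[OF assms(1,2) smooth_vfield_scale[OF assms(3,4)] assms(5,6)]
    leibniz[OF assms(1-4,6)] by simp

lemma D_diff:
  assumes "open V" "p \<in> V" "smooth_vfield A V Y" "smooth_vfield A V Z" "v \<in> tangent_space A p"
  shows "D p v (\<lambda>q f. Y q f - Z q f) = (\<lambda>f. D p v Y f - D p v Z f)"
  using D_lincomb[OF assms(1,2) smooth_fun_const[of V "-1"] assms(4,3,5)] tangent_const[OF assms(5)]
  by simp

lemma D_zero:
  assumes "open V" "p \<in> V" "smooth_vfield A V Y" "v \<in> tangent_space A p"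
    "\<And>q. q \<in> V \<Longrightarrow> Y q = (\<lambda>f. 0)"
  shows "D p v Y = (\<lambda>f. 0)"
proof -
  have "D p v Y = D p v (\<lambda>q f. Y q f - Y q f)"
    by (rule local[OF assms(1-3) smooth_vfield_diff[OF assms(3,3)]]) (use assms(4,5) in auto)
  then show ?thesis using D_diff[OF assms(1-3,3,4)] by simp
qed

lemma D_direction_scale:
  assumes "open V" "p \<in> V" "smooth_vfield A V Y" "u \<in> tangent_space A p"
  shows "D p (\<lambda>f. a * u f) Y = (\<lambda>f. a * D p u Y f)"
  using linear_direction[OF assms(1-4,4), of a 0] by simp

lemma D_direction_add:
  assumes "open V" "p \<in> V" "smooth_vfield A V Y" "u \<in> tangent_space A p" "v \<in> tangent_space A p"
  shows "D p (\<lambda>f. u f + v f) Y = (\<lambda>f. D p u Y f + D p v Y f)"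
  using linear_direction[OF assms, of 1 1] by simp

lemma bracket_eq:
  assumes "open V" "smooth_vfield A V X" "smooth_vfield A V Y" "p \<in> V"
  shows "lie_bracket A X Y p = (\<lambda>f. D p (X p) Y f - D p (Y p) X f)"
  using torsion_free[OF assms(1,4,2,3)] by simp

text \<open>Absence of torsion also makes the Lie bracket of smooth fields a smooth field.\<close>

lemma bracket_smooth:
  assumes V: "open V" "smooth_vfield A V X" "smooth_vfield A V Y"
  shows "smooth_vfield A V (lie_bracket A X Y)"
proof (rule smooth_vfield_cong)
  show "smooth_vfield A V (\<lambda>p f. D p (X p) Y f - D p (Y p) X f)"
    by (intro smooth_vfield_diff smooth V)
qed (rule bracket_eq[OF V, symmetric])

text \<open>The vector \<open>R(X, Y) Z\<close>, from which the 4-tensor is obtained by pairing with a last argument.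
  Identities between vectors can be differentiated once more, which the second Bianchi identity calls for.\<close>

definition curvature :: "'a vfield \<Rightarrow> 'a vfield \<Rightarrow> 'a vfield \<Rightarrow> 'a vfield" where
  "curvature X Y Z =
     (\<lambda>p f. D p (X p) (nabla D Y Z) f - D p (Y p) (nabla D X Z) f - D p (lie_bracket A X Y p) Z f)"

lemma riemann_curvature: "riemann A g D X Y Z W p = g p (curvature X Y Z p) (W p)"
  by (simp add: riemann_def curvature_def nabla_def)

lemma curvature_smooth:
  assumes "open V" "smooth_vfield A V X" "smooth_vfield A V Y" "smooth_vfield A V Z"
  shows "smooth_vfield A V (curvature X Y Z)"
  unfolding curvature_def
  by (intro smooth_vfield_diff smooth nabla_smooth bracket_smooth assms)

lemma curvature_flip:
  assumes "open V" "p \<in> V" "smooth_vfield A V X" "smooth_vfield A V Y" "smooth_vfield A V Z"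
  shows "curvature Y X Z p f = - curvature X Y Z p f"
proof -
  have "lie_bracket A Y X p = (\<lambda>f. (-1) * lie_bracket A X Y p f)"
    by (rule ext) (simp add: lie_bracket_flip[of X Y])
  then have "D p (lie_bracket A Y X p) Z f = - D p (lie_bracket A X Y p) Z f"
    using D_direction_scale[OF assms(1,2,5) vfield_tangent[OF bracket_smooth[OF assms(1,3,4)] assms(2)],
        of "-1"] by simp
  then show ?thesis by (simp add: curvature_def)
qed

lemma curvature_cong:
  assumes V: "open V" "p \<in> V"
    and s: "smooth_vfield A V X" "smooth_vfield A V Y" "smooth_vfield A V Z"
    and s': "smooth_vfield A V X'" "smooth_vfield A V Y'" "smooth_vfield A V Z'"
    and eq: "\<And>q. q \<in> V \<Longrightarrow> X q = X' q" "\<And>q. q \<in> V \<Longrightarrow> Y q = Y' q" "\<And>q. q \<in> V \<Longrightarrow> Z q = Z' q"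
  shows "curvature X Y Z p = curvature X' Y' Z' p"
proof -
  have e: "\<forall>q\<in>V. X q = X' q" "\<forall>q\<in>V. Y q = Y' q" "\<forall>q\<in>V. Z q = Z' q" using eq by auto
  have nab: "\<forall>q\<in>V. nabla D P Q q = nabla D P' Q' q"
    if P: "smooth_vfield A V P" and Q: "smooth_vfield A V Q" "smooth_vfield A V Q'"
      and eq: "\<forall>q\<in>V. P q = P' q" "\<forall>q\<in>V. Q q = Q' q" for P Q P' Q'
  proof
    fix q assume q: "q \<in> V"
    have "D q (P q) Q = D q (P q) Q'"
      by (rule local[OF V(1) q Q _ vfield_tangent[OF P q]]) (use eq(2) in auto)
    then show "nabla D P Q q = nabla D P' Q' q" using eq(1) q by (simp add: nabla_def)
  qed
  note n = nab[OF s(2,3) s'(3) e(2,3)] nab[OF s(1,3) s'(3) e(1,3)]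
    nab[OF s(1,2) s'(2) e(1,2)] nab[OF s(2,1) s'(1) e(2,1)]
  have br: "lie_bracket A X Y p = lie_bracket A X' Y' p"
    using n(3,4) V(2)
    by (simp add: bracket_eq[OF V(1) s(1,2) V(2)] bracket_eq[OF V(1) s'(1,2) V(2)] nabla_def)
  have "nabla D X (nabla D Y Z) p = nabla D X' (nabla D Y' Z') p"
    using nab[OF s(1) nabla_smooth[OF V(1) s(2,3)] nabla_smooth[OF V(1) s'(2,3)] e(1) n(1)] V(2) by blast
  moreover have "nabla D Y (nabla D X Z) p = nabla D Y' (nabla D X' Z') p"
    using nab[OF s(2) nabla_smooth[OF V(1) s(1,3)] nabla_smooth[OF V(1) s'(1,3)] e(2) n(2)] V(2) by blast
  moreover have "D p (lie_bracket A X Y p) Z = D p (lie_bracket A X Y p) Z'"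
    by (rule local[OF V s(3) s'(3) eq(3) vfield_tangent[OF bracket_smooth[OF V(1) s(1,2)] V(2)]])
  ultimately show ?thesis by (simp add: curvature_def br nabla_def)
qed

text \<open>Linearity over functions: a derivative of \<open>h\<close> arises twice and cancels. In the first
  argument \<open>\<nabla>\<^sub>Y (h X)\<close> meets the term \<open>- (Y h) X\<close> of \<open>[h X, Y]\<close>; in the third
  argument the second derivatives of \<open>h\<close> meet \<open>[X, Y] h\<close>.\<close>

lemma curvature_lincomb_1:
  assumes V: "open V" "p \<in> V" and h: "smooth_fun A V h"
    and X: "smooth_vfield A V X" and X': "smooth_vfield A V X'"
    and Y: "smooth_vfield A V Y" and Z: "smooth_vfield A V Z"
  shows "curvature (\<lambda>q f. h q * X q f + X' q f) Y Z p f = h p * curvature X Y Z p f + curvature X' Y Z p f"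
proof -
  let ?X = "\<lambda>q f. h q * X q f + X' q f"
  have sX: "smooth_vfield A V ?X"
    by (intro smooth_vfield_add smooth_vfield_scale h X X')
  note T = vfield_tangent[OF X] vfield_tangent[OF X'] vfield_tangent[OF Y]
  have dir: "D q (?X q) S = (\<lambda>f. h q * D q (X q) S f + D q (X' q) S f)"
    if "q \<in> V" "smooth_vfield A V S" for q S
    using linear_direction[OF V(1) that T(1,2)[OF that(1)], of "h q" 1] by simp
  have "D p (Y p) (nabla D ?X Z) = D p (Y p) (\<lambda>q f. h q * nabla D X Z q f + nabla D X' Z q f)"
    by (rule local[OF V nabla_smooth[OF V(1) sX Z] _ _ T(3)[OF V(2)]])
       (auto simp: nabla_def dir Z intro!: smooth_vfield_add smooth_vfield_scale h smooth V X X' Z)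
  also have "\<dots> = (\<lambda>f. Y p h * nabla D X Z p f + h p * D p (Y p) (nabla D X Z) f
                         + D p (Y p) (nabla D X' Z) f)"
    by (rule D_lincomb[OF V h nabla_smooth[OF V(1) X Z] nabla_smooth[OF V(1) X' Z] T(3)[OF V(2)]])
  finally have c2: "D p (Y p) (nabla D ?X Z) = \<dots>" .
  have bX: "lie_bracket A X Y p \<in> tangent_space A p" "lie_bracket A X' Y p \<in> tangent_space A p"
    using vfield_tangent[OF bracket_smooth[OF V(1) _ Y] V(2)] X X' by blast+
  have "lie_bracket A ?X Y p =
          (\<lambda>f. (h p * lie_bracket A X Y p f + lie_bracket A X' Y p f) + (- Y p h) * X p f)"
    unfolding bracket_eq[OF V(1) sX Y V(2)] bracket_eq[OF V(1) X Y V(2)]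
      bracket_eq[OF V(1) X' Y V(2)] dir[OF V(2) Y] D_lincomb[OF V h X X' T(3)[OF V(2)]]
    by (rule ext) (simp add: algebra_simps)
  then have c3: "D p (lie_bracket A ?X Y p) Z =
      (\<lambda>f. (h p * D p (lie_bracket A X Y p) Z f + D p (lie_bracket A X' Y p) Z f)
            + (- Y p h) * D p (X p) Z f)"
    by (simp only: D_direction_add[OF V Z] D_direction_scale[OF V Z] bX T(1)[OF V(2)]
        tangent_add tangent_scale)
  show ?thesis
    unfolding curvature_def c2 c3 dir[OF V(2) nabla_smooth[OF V(1) Y Z]]
    by (simp add: nabla_def algebra_simps)
qed

lemma curvature_lincomb_2:
  assumes V: "open V" "p \<in> V" and h: "smooth_fun A V h"
    and X: "smooth_vfield A V X" and Y: "smooth_vfield A V Y" and Y': "smooth_vfield A V Y'"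
    and Z: "smooth_vfield A V Z"
  shows "curvature X (\<lambda>q f. h q * Y q f + Y' q f) Z p f = h p * curvature X Y Z p f + curvature X Y' Z p f"
  using curvature_lincomb_1[OF V h Y Y' X Z, of f]
    curvature_flip[OF V X Y Z, of f] curvature_flip[OF V X Y' Z, of f]
    curvature_flip[OF V X smooth_vfield_add[OF smooth_vfield_scale[OF h Y] Y'] Z, of f]
  by simp

lemma curvature_lincomb_3:
  assumes V: "open V" "p \<in> V" and h: "smooth_fun A V h"
    and X: "smooth_vfield A V X" and Y: "smooth_vfield A V Y"
    and Z: "smooth_vfield A V Z" and Z': "smooth_vfield A V Z'"
  shows "curvature X Y (\<lambda>q f. h q * Z q f + Z' q f) p f = h p * curvature X Y Z p f + curvature X Y Z' p f"
proof -
  let ?Z = "\<lambda>q f. h q * Z q f + Z' q f"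
  have sZ: "smooth_vfield A V ?Z"
    by (intro smooth_vfield_add smooth_vfield_scale h Z Z')
  have second: "D p (S p) (nabla D T ?Z) =
      (\<lambda>f. S p (\<lambda>q. T q h) * Z p f + T p h * D p (S p) Z f
         + (S p h * D p (T p) Z f + h p * D p (S p) (nabla D T Z) f + D p (S p) (nabla D T Z') f))"
    if S: "smooth_vfield A V S" and T: "smooth_vfield A V T" for S T
  proof -
    have Th: "smooth_fun A V (\<lambda>q. T q h)" by (rule vfield_smooth_fun[OF T V(1) _ h]) simp
    note n = nabla_smooth[OF V(1) T Z] nabla_smooth[OF V(1) T Z']
    have s: "smooth_vfield A V (\<lambda>q f. h q * nabla D T Z q f + nabla D T Z' q f)"
      by (intro smooth_vfield_add smooth_vfield_scale h n)
    have "D p (S p) (nabla D T ?Z) =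
        D p (S p) (\<lambda>q f. T q h * Z q f + (h q * nabla D T Z q f + nabla D T Z' q f))"
    proof (rule local[OF V nabla_smooth[OF V(1) T sZ] _ _ vfield_tangent[OF S V(2)]])
      show "smooth_vfield A V (\<lambda>q f. T q h * Z q f + (h q * nabla D T Z q f + nabla D T Z' q f))"
        by (intro smooth_vfield_add[OF smooth_vfield_scale[OF Th Z]] s)
      show "nabla D T ?Z q = (\<lambda>f. T q h * Z q f + (h q * nabla D T Z q f + nabla D T Z' q f))"
        if "q \<in> V" for q
        using D_lincomb[OF V(1) that h Z Z' vfield_tangent[OF T that]] by (simp add: nabla_def add.assoc)
    qed
    then show ?thesis
      using D_lincomb[OF V Th Z s vfield_tangent[OF S V(2)]]
        D_lincomb[OF V h n vfield_tangent[OF S V(2)]]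
      by (simp add: nabla_def)
  qed
  have br: "lie_bracket A X Y p h = X p (\<lambda>q. Y q h) - Y p (\<lambda>q. X q h)"
    by (rule lie_bracket_apply[OF smooth_nearI[OF V h]])
  show ?thesis
    unfolding curvature_def br second[OF X Y] second[OF Y X]
      D_lincomb[OF V h Z Z' vfield_tangent[OF bracket_smooth[OF V(1) X Y] V(2)]]
    by (simp add: algebra_simps)
qed

lemma curvature_tensorial:
  assumes "open V" "p \<in> V" "smooth_vfield A V X" "smooth_vfield A V Y" "smooth_vfield A V Z"
  shows "tensorial_at V p (\<lambda>X. curvature X Y Z p f)"
    and "tensorial_at V p (\<lambda>Y. curvature X Y Z p f)"
    and "tensorial_at V p (\<lambda>Z. curvature X Y Z p f)"
proof -
  note V = assms(1,2) and X = assms(3) and Y = assms(4) and Z = assms(5)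
  show "tensorial_at V p (\<lambda>X. curvature X Y Z p f)"
  proof (rule tensorial_atI)
    fix X X' assume "smooth_vfield A V X" "smooth_vfield A V X'" "\<And>q. q \<in> V \<Longrightarrow> X q = X' q"
    then have "curvature X Y Z p = curvature X' Y Z p"
      by (intro curvature_cong[OF V _ Y Z _ Y Z]) auto
    then show "curvature X Y Z p f = curvature X' Y Z p f" by simp
  qed (rule curvature_lincomb_1[OF V _ _ _ Y Z])
  show "tensorial_at V p (\<lambda>Y. curvature X Y Z p f)"
  proof (rule tensorial_atI)
    fix Y Y' assume "smooth_vfield A V Y" "smooth_vfield A V Y'" "\<And>q. q \<in> V \<Longrightarrow> Y q = Y' q"
    then have "curvature X Y Z p = curvature X Y' Z p"
      by (intro curvature_cong[OF V X _ Z X _ Z]) auto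
    then show "curvature X Y Z p f = curvature X Y' Z p f" by simp
  qed (rule curvature_lincomb_2[OF V _ X _ _ Z])
  show "tensorial_at V p (\<lambda>Z. curvature X Y Z p f)"
  proof (rule tensorial_atI)
    fix Z Z' assume "smooth_vfield A V Z" "smooth_vfield A V Z'" "\<And>q. q \<in> V \<Longrightarrow> Z q = Z' q"
    then have "curvature X Y Z p = curvature X Y Z' p"
      by (intro curvature_cong[OF V X Y _ X Y]) auto
    then show "curvature X Y Z p f = curvature X Y Z' p f" by simp
  qed (rule curvature_lincomb_3[OF V _ X Y])
qed

lemma tensorial_at_metric:
  assumes u: "\<And>f. tensorial_at V p (\<lambda>X. u X f)"
    and T: "\<And>X. smooth_vfield A V X \<Longrightarrow> u X \<in> tangent_space A p" and w: "w \<in> tangent_space A p"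
  shows "tensorial_at V p (\<lambda>X. g p (u X) w)"
proof (rule tensorial_atI)
  fix h X Y assume h: "smooth_fun A V h" and X: "smooth_vfield A V X" and Y: "smooth_vfield A V Y"
  have "u (\<lambda>q f. h q * X q f + Y q f) = (\<lambda>f. h p * u X f + 1 * u Y f)"
    using u h X Y unfolding tensorial_at_def by (intro ext) simp
  then show "g p (u (\<lambda>q f. h q * X q f + Y q f)) w = h p * g p (u X) w + g p (u Y) w"
    using metric_linear[OF T[OF X] T[OF Y] w, of "h p" 1] by (simp only: mult_1)
next
  fix X Y assume "smooth_vfield A V X" "smooth_vfield A V Y" "\<And>q. q \<in> V \<Longrightarrow> X q = Y q"
  then have "u X = u Y"
    using u unfolding tensorial_at_def by (intro ext) blast
  then show "g p (u X) w = g p (u Y) w" by simp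
qed

lemma riemann_tensorial:
  assumes V: "open V" "p \<in> V" and X: "smooth_vfield A V X" and Y: "smooth_vfield A V Y"
    and Z: "smooth_vfield A V Z" and W: "smooth_vfield A V W"
  shows "tensorial_at V p (\<lambda>X. riemann A g D X Y Z W p)"
    and "tensorial_at V p (\<lambda>Y. riemann A g D X Y Z W p)"
    and "tensorial_at V p (\<lambda>Z. riemann A g D X Y Z W p)"
    and "tensorial_at V p (\<lambda>W. riemann A g D X Y Z W p)"
proof -
  have T: "curvature X Y Z p \<in> tangent_space A p"
    if "smooth_vfield A V X" "smooth_vfield A V Y" "smooth_vfield A V Z" for X Y Z
    by (rule vfield_tangent[OF curvature_smooth[OF V(1) that] V(2)])
  note WT = vfield_tangent[OF W V(2)] and c = curvature_tensorial[OF V X Y Z]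
  show "tensorial_at V p (\<lambda>X. riemann A g D X Y Z W p)"
    unfolding riemann_curvature by (rule tensorial_at_metric[OF c(1) T[OF _ Y Z] WT])
  show "tensorial_at V p (\<lambda>Y. riemann A g D X Y Z W p)"
    unfolding riemann_curvature by (rule tensorial_at_metric[OF c(2) T[OF X _ Z] WT])
  show "tensorial_at V p (\<lambda>Z. riemann A g D X Y Z W p)"
    unfolding riemann_curvature by (rule tensorial_at_metric[OF c(3) T[OF X Y] WT])
  show "tensorial_at V p (\<lambda>W. riemann A g D X Y Z W p)"
    using T[OF X Y Z] V(2)
    by (intro tensorial_atI)
       (auto simp: riemann_curvature metric_add_right metric_scale_right vfield_tangent tangent_scale)
qed

text \<open>The frame that enters the trace at \<open>p\<close> is chosen anew at each point, so as it stands the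
  scalar curvature is not visibly a smooth function. A single frame on a neighbourhood makes it one.\<close>

lemma scalar_curvature_frame:
  assumes F: "orthonormal_frame A g V F" and V: "open V" "p \<in> V"
  shows "scalar_curvature A g D p = (\<Sum>b\<in>UNIV. \<Sum>a\<in>UNIV. riemann A g D (F a) (F b) (F b) (F a) p)"
proof -
  define E where "E = frame_near A g p"
  obtain W where W: "open W" "p \<in> W" "orthonormal_frame A g W E"
    unfolding E_def by (rule frame_near)
  let ?V = "V \<inter> W"
  have o: "open ?V" "p \<in> ?V" using V W by auto
  have E: "orthonormal_frame A g ?V E" and F: "orthonormal_frame A g ?V F"
    using orthonormal_frame_mono[OF W(3)] orthonormal_frame_mono[OF F] by auto
  note Es = orthonormal_frame_vfield[OF E] and Fs = orthonormal_frame_vfield[OF F]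
  have "ricci A g D v w p = (\<Sum>a\<in>UNIV. riemann A g D (F a) v w (F a) p)"
    if "smooth_vfield A ?V v" "smooth_vfield A ?V w" for v w
    unfolding ricci_def E_def[symmetric]
    using riemann_tensorial[OF o _ that]
    by (intro trace_frame_independent[OF _ _ E F o]) blast+
  then have "scalar_curvature A g D p =
      (\<Sum>i\<in>UNIV. \<Sum>a\<in>UNIV. riemann A g D (F a) (E i) (E i) (F a) p)"
    by (simp add: scalar_curvature_def E_def[symmetric] Es)
  also have "\<dots> = (\<Sum>a\<in>UNIV. \<Sum>i\<in>UNIV. riemann A g D (F a) (E i) (E i) (F a) p)"
    by (rule sum.swap)
  also have "\<dots> = (\<Sum>a\<in>UNIV. \<Sum>b\<in>UNIV. riemann A g D (F a) (F b) (F b) (F a) p)"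
  proof (rule sum.cong[OF refl])
    fix a
    show "(\<Sum>i\<in>UNIV. riemann A g D (F a) (E i) (E i) (F a) p) =
          (\<Sum>b\<in>UNIV. riemann A g D (F a) (F b) (F b) (F a) p)"
      using riemann_tensorial[OF o Fs _ _ Fs]
      by (intro trace_frame_independent[OF _ _ E F o]) blast+
  qed
  also have "\<dots> = (\<Sum>b\<in>UNIV. \<Sum>a\<in>UNIV. riemann A g D (F a) (F b) (F b) (F a) p)"
    by (rule sum.swap)
  finally show ?thesis .
qed

lemma divergence_frame:
  assumes F: "orthonormal_frame A g V F" and V: "open V" "p \<in> V" and X: "smooth_vfield A V X"
  shows "divergence A g D X p = (\<Sum>a\<in>UNIV. g p (D p (F a p) X) (F a p))"
proof -
  define E where "E = frame_near A g p"
  obtain W where W: "open W" "p \<in> W" "orthonormal_frame A g W E"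
    unfolding E_def by (rule frame_near)
  let ?V = "V \<inter> W"
  have o: "open ?V" "p \<in> ?V" using V W by auto
  have E: "orthonormal_frame A g ?V E" and F: "orthonormal_frame A g ?V F"
    using orthonormal_frame_mono[OF W(3)] orthonormal_frame_mono[OF F] by auto
  have X: "smooth_vfield A ?V X" using smooth_vfield_mono[OF X] by blast
  let ?B = "\<lambda>Y Z. g p (D p (Y p) X) (Z p)"
  have T: "Y p \<in> tangent_space A p" "D p (Y p) X \<in> tangent_space A p"
    if "smooth_vfield A ?V Y" for Y
    using vfield_tangent[OF that o(2)] nabla_tangent[OF o(1) that X o(2)] by auto
  have "(\<Sum>i\<in>UNIV. ?B (E i) (E i)) = (\<Sum>a\<in>UNIV. ?B (F a) (F a))"
  proof (rule trace_frame_independent[where B = ?B, OF _ _ E F o])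
    fix Z assume Z: "smooth_vfield A ?V Z"
    show "tensorial_at ?V p (\<lambda>Y. ?B Y Z)"
    proof (rule tensorial_atI)
      fix h Y Y' assume Y: "smooth_vfield A ?V Y" "smooth_vfield A ?V Y'"
      show "?B (\<lambda>q f. h q * Y q f + Y' q f) Z = h p * ?B Y Z + ?B Y' Z"
        using linear_direction[OF o X T(1)[OF Y(1)] T(1)[OF Y(2)], of "h p" 1]
          metric_linear[OF T(2)[OF Y(1)] T(2)[OF Y(2)] T(1)[OF Z], of "h p" 1] by simp
    qed (use o in auto)
    show "tensorial_at ?V p (?B Z)"
      using o(2) T[OF Z]
      by (intro tensorial_atI)
         (auto simp: metric_add_right metric_scale_right T(1) tangent_scale)
  qed
  then show ?thesis by (simp add: divergence_def E_def)
qed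

text \<open>Apply \<open>[X, Y] = XY - YX\<close> to the function \<open>g(Z, W)\<close> and differentiate with the metric.\<close>

lemma curvature_skew:
  assumes V: "open V" "p \<in> V" and X: "smooth_vfield A V X" and Y: "smooth_vfield A V Y"
    and Z: "smooth_vfield A V Z" and W: "smooth_vfield A V W"
  shows "g p (curvature X Y Z p) (W p) = - g p (curvature X Y W p) (Z p)"
proof -
  let ?G = "\<lambda>q. g q (Z q) (W q)"
  have G: "smooth_fun A V ?G" by (rule metric_smooth[OF V(1) Z W])
  have second: "S p (\<lambda>q. T q ?G) =
      g p (D p (S p) (nabla D T Z)) (W p) + g p (D p (T p) Z) (D p (S p) W)
      + (g p (D p (S p) Z) (D p (T p) W) + g p (Z p) (D p (S p) (nabla D T W)))"
    if S: "smooth_vfield A V S" and T: "smooth_vfield A V T" for S T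
  proof -
    note n = nabla_smooth[OF V(1) T Z] nabla_smooth[OF V(1) T W]
    note ST = vfield_tangent[OF S V(2)]
    have "S p (\<lambda>q. T q ?G) = S p (\<lambda>q. g q (nabla D T Z q) (W q) + g q (Z q) (nabla D T W q))"
      using metric_compatible[OF V(1) _ Z W vfield_tangent[OF T]]
      by (intro tangent_cong[OF ST V]) (simp add: nabla_def)
    also have "\<dots> = S p (\<lambda>q. g q (nabla D T Z q) (W q)) + S p (\<lambda>q. g q (Z q) (nabla D T W q))"
      by (rule tangent_of_add[OF ST smooth_nearI[OF V metric_smooth[OF V(1) n(1) W]]
            smooth_nearI[OF V metric_smooth[OF V(1) Z n(2)]]])
    finally show ?thesis
      unfolding metric_compatible[OF V n(1) W ST] metric_compatible[OF V Z n(2) ST]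
      by (simp add: nabla_def)
  qed
  have br: "lie_bracket A X Y p \<in> tangent_space A p"
    by (rule vfield_tangent[OF bracket_smooth[OF V(1) X Y] V(2)])
  have T: "Z p \<in> tangent_space A p" "W p \<in> tangent_space A p"
    using vfield_tangent[OF Z V(2)] vfield_tangent[OF W V(2)] .
  have "lie_bracket A X Y p ?G = X p (\<lambda>q. Y q ?G) - Y p (\<lambda>q. X q ?G)"
    by (rule lie_bracket_apply[OF smooth_nearI[OF V G]])
  then have *: "g p (D p (lie_bracket A X Y p) Z) (W p) + g p (Z p) (D p (lie_bracket A X Y p) W) =
      g p (D p (X p) (nabla D Y Z)) (W p) - g p (D p (Y p) (nabla D X Z)) (W p)
      + (g p (Z p) (D p (X p) (nabla D Y W)) - g p (Z p) (D p (Y p) (nabla D X W)))"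
    using metric_compatible[OF V Z W br]
    unfolding second[OF X Y] second[OF Y X] by linarith
  have split: "g p (curvature X Y S p) w =
      g p (D p (X p) (nabla D Y S)) w - g p (D p (Y p) (nabla D X S)) w
      - g p (D p (lie_bracket A X Y p) S) w" if S: "smooth_vfield A V S" and w: "w \<in> tangent_space A p" for S w
  proof -
    have "D p (X p) (nabla D Y S) \<in> tangent_space A p" "D p (Y p) (nabla D X S) \<in> tangent_space A p"
      "D p (lie_bracket A X Y p) S \<in> tangent_space A p"
      by (intro nabla_tangent[OF V(1) _ _ V(2)] nabla_smooth bracket_smooth V X Y S)+
    then show ?thesis
      unfolding curvature_def by (simp add: metric_diff_left tangent_diff w)
  qed
  have "g p (Z p) u = g p u (Z p)" if "u \<in> tangent_space A p" for u
    by (rule metric_sym[OF T(1) that])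
  moreover have "D p (X p) (nabla D Y W) \<in> tangent_space A p"
      "D p (Y p) (nabla D X W) \<in> tangent_space A p" "D p (lie_bracket A X Y p) W \<in> tangent_space A p"
    by (intro nabla_tangent[OF V(1) _ _ V(2)] nabla_smooth bracket_smooth V X Y W)+
  ultimately show ?thesis
    using * split[OF Z T(2)] split[OF W T(1)] by simp
qed

lemma D_jacobi:
  assumes V: "open V" "p \<in> V" and X: "smooth_vfield A V X" and Y: "smooth_vfield A V Y"
    and Z: "smooth_vfield A V Z" and S: "smooth_vfield A V S"
  shows "D p (lie_bracket A X (lie_bracket A Y Z) p) S f + D p (lie_bracket A Y (lie_bracket A Z X) p) S f
         + D p (lie_bracket A Z (lie_bracket A X Y) p) S f = 0"
proof -
  let ?a = "lie_bracket A X (lie_bracket A Y Z) p" and ?b = "lie_bracket A Y (lie_bracket A Z X) p"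
    and ?c = "lie_bracket A Z (lie_bracket A X Y) p"
  have T: "?a \<in> tangent_space A p" "?b \<in> tangent_space A p" "?c \<in> tangent_space A p"
    by (intro vfield_tangent[OF _ V(2)] bracket_smooth V X Y Z)+
  have "(\<lambda>f. (?a f + ?b f) + ?c f) = (\<lambda>f. 0 * ?a f)"
    using lie_bracket_jacobi[OF V X Y Z] by (intro ext) simp
  then have "D p (\<lambda>f. (?a f + ?b f) + ?c f) S = (\<lambda>f. 0)"
    using D_direction_scale[OF V S T(1), of 0] by simp
  moreover have "D p (\<lambda>f. (?a f + ?b f) + ?c f) S = (\<lambda>f. (D p ?a S f + D p ?b S f) + D p ?c S f)"
    by (simp only: D_direction_add[OF V S] T tangent_add)
  ultimately show ?thesis by (auto dest: fun_cong)
qed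

text \<open>Without torsion, the six second derivatives combine to derivatives of brackets, and together with
  the remaining three terms to double brackets, whose cyclic sum is zero.\<close>

lemma first_bianchi:
  assumes V: "open V" "p \<in> V" and X: "smooth_vfield A V X" and Y: "smooth_vfield A V Y"
    and Z: "smooth_vfield A V Z"
  shows "curvature X Y Z p f + curvature Y Z X p f + curvature Z X Y p f = 0"
proof -
  have pair: "D p (R p) (nabla D S T) f - D p (R p) (nabla D T S) f - D p (lie_bracket A S T p) R f
                = lie_bracket A R (lie_bracket A S T) p f"
    if R: "smooth_vfield A V R" and S: "smooth_vfield A V S" and T: "smooth_vfield A V T" for R S T
  proof -
    note n = nabla_smooth[OF V(1) S T] nabla_smooth[OF V(1) T S]
    note b = bracket_smooth[OF V(1) S T]
    have "D p (R p) (lie_bracket A S T) = D p (R p) (\<lambda>q f. nabla D S T q f - nabla D T S q f)"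
      by (rule local[OF V b smooth_vfield_diff[OF n] _ vfield_tangent[OF R V(2)]])
         (simp add: bracket_eq[OF V(1) S T] nabla_def)
    then show ?thesis
      using D_diff[OF V n vfield_tangent[OF R V(2)]] bracket_eq[OF V(1) R b V(2)] by simp
  qed
  show ?thesis
    using pair[OF X Y Z] pair[OF Y Z X] pair[OF Z X Y] lie_bracket_jacobi[OF V X Y Z, of f]
    unfolding curvature_def by linarith
qed

text \<open>The second Bianchi identity, in a form without the covariant derivative of the curvature: it
  is the Jacobi identity for the commutators of the operators \<open>\<nabla>\<^sub>X\<close>,
  \<open>\<nabla>\<^sub>Y\<close>, \<open>\<nabla>\<^sub>Z\<close>, rewritten with
  \<open>[\<nabla>\<^sub>X, \<nabla>\<^sub>Y] = R(X, Y) + \<nabla>\<^bsub>[X, Y]\<^esub>\<close> and the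
  Jacobi identity for the fields themselves.\<close>

lemma second_bianchi:
  assumes V: "open V" "p \<in> V" and X: "smooth_vfield A V X" and Y: "smooth_vfield A V Y"
    and Z: "smooth_vfield A V Z" and S: "smooth_vfield A V S"
  shows "(D p (X p) (curvature Y Z S) f - curvature Y Z (nabla D X S) p f
            + curvature X (lie_bracket A Y Z) S p f)
       + (D p (Y p) (curvature Z X S) f - curvature Z X (nabla D Y S) p f
            + curvature Y (lie_bracket A Z X) S p f)
       + (D p (Z p) (curvature X Y S) f - curvature X Y (nabla D Z S) p f
            + curvature Z (lie_bracket A X Y) S p f) = 0"
proof -
  have Dcurv: "D p (P p) (curvature Q R S) f =
      D p (P p) (nabla D Q (nabla D R S)) f - D p (P p) (nabla D R (nabla D Q S)) f
      - D p (P p) (nabla D (lie_bracket A Q R) S) f"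
    if P: "smooth_vfield A V P" and Q: "smooth_vfield A V Q" and R: "smooth_vfield A V R" for P Q R
  proof -
    note PT = vfield_tangent[OF P V(2)]
    have n: "smooth_vfield A V (nabla D Q (nabla D R S))" "smooth_vfield A V (nabla D R (nabla D Q S))"
      "smooth_vfield A V (nabla D (lie_bracket A Q R) S)"
      by (intro nabla_smooth bracket_smooth V Q R S)+
    have "curvature Q R S =
        (\<lambda>q f. (\<lambda>q f. nabla D Q (nabla D R S) q f - nabla D R (nabla D Q S) q f) q f
           - nabla D (lie_bracket A Q R) S q f)"
      by (simp add: curvature_def nabla_def)
    then show ?thesis
      using D_diff[OF V smooth_vfield_diff[OF n(1,2)] n(3) PT] D_diff[OF V n(1,2) PT] by simp
  qed
  show ?thesis
    using D_jacobi[OF V X Y Z S, of f]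
    unfolding Dcurv[OF X Y Z] Dcurv[OF Y Z X] Dcurv[OF Z X Y]
    by (simp add: curvature_def nabla_def)
qed

end

section \<open>Two-principal fields on a 3-manifold\<close>

text \<open>Multiplying \<open>s\<close> by \<open>exp\<close> of an antiderivative of \<open>d\<close> gives a constant.\<close>

lemma linear_ode_nonzero:
  fixes s d :: "real \<Rightarrow> real"
  assumes "a \<le> b" and s: "\<And>t. t \<in> {a..b} \<Longrightarrow> (s has_real_derivative - d t * s t) (at t)"
    and d: "continuous_on {a..b} d"
  shows "s a \<noteq> 0 \<longleftrightarrow> s b \<noteq> 0"
proof -
  obtain H where H: "\<And>t. t \<in> {a..b} \<Longrightarrow> (H has_vector_derivative d t) (at t within {a..b})"
    using antiderivative_continuous[OF d] by blast
  have "\<exists>c. \<forall>t\<in>{a..b}. s t * exp (H t) = c"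
  proof (rule has_field_derivative_zero_constant)
    fix t assume t: "t \<in> {a..b}"
    have 1: "(s has_real_derivative - d t * s t) (at t within {a..b})"
      using s[OF t] by (rule has_field_derivative_at_within)
    have 2: "(H has_real_derivative d t) (at t within {a..b})"
      using H[OF t] by (simp add: has_real_derivative_iff_has_vector_derivative)
    show "((\<lambda>t. s t * exp (H t)) has_real_derivative 0) (at t within {a..b})"
      using 1 2 by (auto intro!: derivative_eq_intros)
  qed simp
  then obtain c where "\<And>t. t \<in> {a..b} \<Longrightarrow> s t * exp (H t) = c" by blast
  from this[of a] this[of b] have "s a * exp (H a) = s b * exp (H b)" using assms(1) by simp
  then show ?thesis by auto
qed

locale two_principal_field = levi_civita_connection A g D
  for A :: "('a::{t2_space, second_countable_topology}, 3) chart set"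
    and g :: "'a \<Rightarrow> 'a tangent \<Rightarrow> 'a tangent \<Rightarrow> real"
    and D :: "'a \<Rightarrow> 'a tangent \<Rightarrow> 'a vfield \<Rightarrow> 'a tangent" +
  fixes U :: "'a set" and k :: "'a vfield"
  assumes open_U: "open U"
    and unit_k: "unit_vfield A g U k"
    and principal: "two_principal A g D U k"
begin

text \<open>All computations take place in a local orthonormal frame \<open>k, F\<^sub>2, F\<^sub>3\<close>.\<close>

lemma adapted_frame_near:
  assumes "p \<in> U"
  obtains W F where "p \<in> W" "open W" "W \<subseteq> U" "orthonormal_frame A g W F" "F 1 = k"
proof -
  have "orthonormal_on U {1} (\<lambda>_. k)"
    using unit_k unfolding unit_vfield_def orthonormal_on_def by auto
  from orthonormal_on_extend_frame[OF open_U assms this] obtain W F where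
    "open W" "p \<in> W" "W \<subseteq> U" "orthonormal_frame A g W F" "F 1 = k" by auto
  then show thesis using that by blast
qed

context
  fixes W :: "'a set" and F :: "3 \<Rightarrow> 'a vfield"
  assumes W: "open W" "W \<subseteq> U" and F: "orthonormal_frame A g W F" and F1: "F 1 = k"
begin

lemma frame_smooth: "smooth_vfield A W (F i)"
  by (rule orthonormal_frame_vfield[OF F])

lemma k_smooth: "smooth_vfield A W k"
  using frame_smooth[of 1] by (simp add: F1)

lemma frame_tangent: "q \<in> W \<Longrightarrow> F i q \<in> tangent_space A q"
  by (rule vfield_tangent[OF frame_smooth])

lemma frame_metric: "q \<in> W \<Longrightarrow> g q (F i q) (F j q) = (if i = j then 1 else 0)"
  by (rule orthonormal_frame_metric[OF F])

lemma frame_expand: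
  assumes "q \<in> W" "v \<in> tangent_space A q"
  shows "v f = g q v (k q) * k q f + g q v (F 2 q) * F 2 q f + g q v (F 3 q) * F 3 q f"
  using fun_cong[OF orthonormal_frame_expand[OF F assms], of f] by (simp add: sum_3 F1)

lemma metric_D_frame:
  assumes q: "q \<in> W" and X: "smooth_vfield A W X"
  shows "g q (D q (X q) (F i)) (F i q) = 0"
proof -
  note Xq = vfield_tangent[OF X q] and T = nabla_tangent[OF W(1) X frame_smooth q]
  have "X q (\<lambda>r. g r (F i r) (F i r)) = X q (\<lambda>r. 1)"
    by (rule tangent_cong[OF Xq W(1) q]) (simp add: frame_metric)
  then show ?thesis
    using metric_compatible[OF W(1) q frame_smooth frame_smooth Xq, of i i] tangent_const[OF Xq]
      metric_sym[OF T frame_tangent[OF q]] by simp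
qed

text \<open>The field \<open>R(k, Y) Z\<close> is itself an admissible last argument in \<open>R(k, Y, Z, \<cdot>) = 0\<close>.\<close>

lemma curvature_k:
  assumes Y: "smooth_vfield A W Y" and Z: "smooth_vfield A W Z" and q: "q \<in> W"
  shows "curvature k Y Z q = (\<lambda>f. 0)"
proof -
  have s: "smooth_vfield A W (curvature k Y Z)" by (rule curvature_smooth[OF W(1) k_smooth Y Z])
  then have "g q (curvature k Y Z q) (curvature k Y Z q) = 0"
    using principal W q Y Z unfolding two_principal_def riemann_curvature by blast
  then show ?thesis by (rule metric_definite[OF vfield_tangent[OF s q]])
qed

lemma curvature_k_2:
  assumes Y: "smooth_vfield A W Y" and Z: "smooth_vfield A W Z" and q: "q \<in> W"
  shows "curvature Y k Z q = (\<lambda>f. 0)"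
  using curvature_flip[OF W(1) q k_smooth Y Z] curvature_k[OF Y Z q] by (intro ext) simp

text \<open>The first Bianchi identity carries the vanishing from the first two arguments to the third.\<close>

lemma curvature_k_3:
  assumes Y: "smooth_vfield A W Y" and Z: "smooth_vfield A W Z" and q: "q \<in> W"
  shows "curvature Y Z k q = (\<lambda>f. 0)"
  using first_bianchi[OF W(1) q Y Z k_smooth] curvature_k[OF Y Z q] curvature_k_2[OF Z Y q]
  by (intro ext) simp

text \<open>The sectional curvature of the plane orthogonal to \<open>k\<close>. By the symmetries, it determines the
  whole curvature tensor where \<open>R(k, \<cdot>) = 0\<close>.\<close>

definition sectional :: "'a \<Rightarrow> real" where
  "sectional q = riemann A g D (F 2) (F 3) (F 3) (F 2) q"

lemma curvature_self:
  assumes "smooth_vfield A W Y" "smooth_vfield A W Z" "q \<in> W"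
  shows "curvature Y Y Z q = (\<lambda>f. 0)"
  using curvature_flip[OF W(1) assms(3,1,1,2)] by (intro ext) (smt (verit))

lemma curvature_component_k:
  assumes "smooth_vfield A W Z" "q \<in> W"
  shows "g q (curvature (F 2) (F 3) Z q) (k q) = 0"
  using curvature_skew[OF W(1) assms(2) frame_smooth frame_smooth assms(1) k_smooth, of 2 3]
    curvature_k_3[OF frame_smooth frame_smooth assms(2)] metric_zero_left[OF vfield_tangent[OF assms]] by simp

lemma curvature_233:
  assumes q: "q \<in> W"
  shows "curvature (F 2) (F 3) (F 3) q = (\<lambda>f. sectional q * F 2 q f)"
proof -
  let ?R = "curvature (F 2) (F 3) (F 3) q"
  have T: "?R \<in> tangent_space A q"
    by (rule vfield_tangent[OF curvature_smooth[OF W(1) frame_smooth frame_smooth frame_smooth] q])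
  have "g q ?R (F 3 q) = 0"
    using curvature_skew[OF W(1) q frame_smooth frame_smooth frame_smooth frame_smooth, of 2 3 3 3] by simp
  then show ?thesis
    using frame_expand[OF q T] curvature_component_k[OF frame_smooth q, of 3]
    by (intro ext) (simp add: sectional_def riemann_curvature)
qed

lemma curvature_232:
  assumes q: "q \<in> W"
  shows "curvature (F 2) (F 3) (F 2) q = (\<lambda>f. - sectional q * F 3 q f)"
proof -
  let ?R = "curvature (F 2) (F 3) (F 2) q"
  have T: "?R \<in> tangent_space A q"
    by (rule vfield_tangent[OF curvature_smooth[OF W(1) frame_smooth frame_smooth frame_smooth] q])
  have "g q ?R (F 2 q) = 0"
    using curvature_skew[OF W(1) q frame_smooth frame_smooth frame_smooth frame_smooth, of 2 3 2 2] by simp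
  moreover have "g q ?R (F 3 q) = - sectional q"
    using curvature_skew[OF W(1) q frame_smooth frame_smooth frame_smooth frame_smooth, of 2 3 2 3] by (simp add: sectional_def riemann_curvature)
  ultimately show ?thesis
    using frame_expand[OF q T] curvature_component_k[OF frame_smooth q, of 2] by (intro ext) simp
qed

lemma curvature_23:
  assumes q: "q \<in> W" and Z: "smooth_vfield A W Z"
  shows "curvature (F 2) (F 3) Z q f =
           sectional q * (g q (Z q) (F 3 q) * F 2 q f - g q (Z q) (F 2 q) * F 3 q f)"
  using tensorial_at_expand[OF curvature_tensorial(3)[OF W(1) q frame_smooth frame_smooth Z] F W(1) q Z, of 2 3 f]
  by (simp add: sum_3 F1 curvature_k_3[OF frame_smooth frame_smooth q] curvature_232[OF q] curvature_233[OF q] algebra_simps)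

lemma scalar_curvature_eq:
  assumes q: "q \<in> W"
  shows "scalar_curvature A g D q = 2 * sectional q"
proof -
  have "curvature (F 3) (F 2) (F 2) q = (\<lambda>f. sectional q * F 3 q f)"
    using curvature_flip[OF W(1) q frame_smooth frame_smooth frame_smooth, of 2 3 2] curvature_232[OF q] by (intro ext) simp
  then have "riemann A g D (F 3) (F 2) (F 2) (F 3) q = sectional q"
    using metric_scale_left[OF frame_tangent[OF q] frame_tangent[OF q], of "sectional q" 3 3] frame_metric[OF q, of 3 3]
    by (simp add: riemann_curvature)
  then show ?thesis
    unfolding scalar_curvature_frame[OF F W(1) q] riemann_curvature sum_3 F1
    using metric_zero_left[OF frame_tangent[OF q]] metric_zero_left[OF vfield_tangent[OF k_smooth q]]
    by (simp add: curvature_k[OF _ _ q] curvature_k_2[OF _ _ q] curvature_k_3[OF _ _ q]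
        curvature_self[OF _ _ q] frame_smooth k_smooth sectional_def riemann_curvature)
qed

lemma divergence_eq:
  assumes q: "q \<in> W"
  shows "divergence A g D k q = g q (D q (F 2 q) k) (F 2 q) + g q (D q (F 3 q) k) (F 3 q)"
  using divergence_frame[OF F W(1) q k_smooth] metric_D_frame[OF q frame_smooth, of 1 1]
  by (simp add: sum_3 F1)

lemma sectional_smooth: "smooth_fun A W sectional"
  unfolding sectional_def riemann_curvature
  by (intro metric_smooth curvature_smooth W frame_smooth)

lemma divergence_smooth: "smooth_fun A W (divergence A g D k)"
proof -
  have "smooth_fun A W (\<lambda>q. g q (nabla D (F 2) k q) (F 2 q) + g q (nabla D (F 3) k q) (F 3 q))"
    by (intro smooth_fun_add metric_smooth nabla_smooth W frame_smooth k_smooth)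
  then show ?thesis
    using divergence_eq
    by (subst smooth_fun_cong[OF W(1), of _ "\<lambda>q. g q (nabla D (F 2) k q) (F 2 q) + g q (nabla D (F 3) k q) (F 3 q)"])
       (simp_all add: nabla_def)
qed

lemma scalar_curvature_smooth: "smooth_fun A W (scalar_curvature A g D)"
  using smooth_fun_mult[OF W(1) smooth_fun_const sectional_smooth, of 2]
    smooth_fun_cong[OF W(1), of "scalar_curvature A g D" "\<lambda>q. 2 * sectional q"] scalar_curvature_eq
  by blast

text \<open>With \<open>R(k, \<cdot>) = 0\<close>, the second Bianchi identity for \<open>k, F\<^sub>2, F\<^sub>3\<close> keeps
  a derivative in the direction \<open>k\<close> only. In the remaining terms
  \<open>R(F\<^sub>2, [F\<^sub>3, k])\<close> and \<open>R(F\<^sub>3, [k, F\<^sub>2])\<close>, a single component of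
  each bracket survives, and these two components add up to the divergence of \<open>k\<close>.\<close>

lemma bianchi_k:
  assumes q: "q \<in> W" and Z: "smooth_vfield A W Z"
  shows "D q (k q) (curvature (F 2) (F 3) Z) f - curvature (F 2) (F 3) (nabla D k Z) q f
           + divergence A g D k q * curvature (F 2) (F 3) Z q f = 0"
proof -
  have brk: "smooth_vfield A W (lie_bracket A X Y)" "smooth_vfield A W (nabla D X Y)"
    if "smooth_vfield A W X" "smooth_vfield A W Y" for X Y
    using bracket_smooth[OF W(1) that] nabla_smooth[OF W(1) that] .
  have comp: "g q (lie_bracket A (F i) k q) (F i q) = g q (D q (F i q) k) (F i q)" for i
    using metric_D_frame[OF q k_smooth, of i]
      nabla_tangent[OF W(1) frame_smooth k_smooth q, of i] nabla_tangent[OF W(1) k_smooth frame_smooth q, of i] frame_tangent[OF q, of i]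
    by (simp add: bracket_eq[OF W(1) frame_smooth k_smooth q] metric_diff_left)
  have comp': "g q (lie_bracket A k (F i) q) (F i q) = - g q (D q (F i q) k) (F i q)" for i
    using metric_D_frame[OF q k_smooth, of i]
      nabla_tangent[OF W(1) frame_smooth k_smooth q, of i] nabla_tangent[OF W(1) k_smooth frame_smooth q, of i] frame_tangent[OF q, of i]
    by (simp add: bracket_eq[OF W(1) k_smooth frame_smooth q] metric_diff_left)
  have ex: "curvature (F i) X Z q f = g q (X q) (k q) * curvature (F i) k Z q f
      + g q (X q) (F 2 q) * curvature (F i) (F 2) Z q f + g q (X q) (F 3 q) * curvature (F i) (F 3) Z q f"
    if X: "smooth_vfield A W X" for X i
    using tensorial_at_expand[OF curvature_tensorial(2)[OF W(1) q frame_smooth X Z] F W(1) q X, of i f]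
    by (simp add: sum_3 F1)
  have r2: "curvature (F 2) (lie_bracket A (F 3) k) Z q f =
      g q (D q (F 3 q) k) (F 3 q) * curvature (F 2) (F 3) Z q f"
    using ex[OF brk(1)[OF frame_smooth k_smooth], of 2 3]
    by (simp add: curvature_k_2[OF frame_smooth Z q] curvature_self[OF frame_smooth Z q] comp)
  have r3: "curvature (F 3) (lie_bracket A k (F 2)) Z q f =
      g q (D q (F 2 q) k) (F 2 q) * curvature (F 2) (F 3) Z q f"
    using ex[OF brk(1)[OF k_smooth frame_smooth], of 3 2] curvature_flip[OF W(1) q frame_smooth frame_smooth Z, of 2 3 f]
    by (simp add: curvature_k_2[OF frame_smooth Z q] curvature_self[OF frame_smooth Z q] comp')
  have d2: "D q (F 2 q) (curvature (F 3) k Z) = (\<lambda>f. 0)"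
    by (rule D_zero[OF W(1) q curvature_smooth[OF W(1) frame_smooth k_smooth Z] frame_tangent[OF q]]) (rule curvature_k_2[OF frame_smooth Z])
  have d3: "D q (F 3 q) (curvature k (F 2) Z) = (\<lambda>f. 0)"
    by (rule D_zero[OF W(1) q curvature_smooth[OF W(1) k_smooth frame_smooth Z] frame_tangent[OF q]]) (rule curvature_k[OF frame_smooth Z])
  show ?thesis
    using second_bianchi[OF W(1) q k_smooth frame_smooth frame_smooth Z, of 2 3 f]
    unfolding d2 d3 r2 r3 curvature_k[OF brk(1)[OF frame_smooth frame_smooth] Z q] curvature_k_2[OF frame_smooth brk(2)[OF frame_smooth Z] q]
      curvature_k[OF frame_smooth brk(2)[OF frame_smooth Z] q] divergence_eq[OF q]
    by (simp add: algebra_simps)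
qed

text \<open>Insert \<open>F\<^sub>3\<close> into the Bianchi identity and take the \<open>F\<^sub>2\<close>-component. The derivatives of the
  frame contribute nothing to it: \<open>\<nabla>\<^sub>k F\<^sub>2\<close> is orthogonal to \<open>F\<^sub>2\<close> and
  \<open>\<nabla>\<^sub>k F\<^sub>3\<close> to \<open>F\<^sub>3\<close>.\<close>

lemma derivative_sectional:
  assumes q: "q \<in> W"
  shows "k q sectional = - divergence A g D k q * sectional q"
proof -
  let ?d = "divergence A g D k q" and ?n = "nabla D k (F 3) q" and ?m = "D q (k q) (F 2)"
  note kq = vfield_tangent[OF k_smooth q]
  have T: "?m \<in> tangent_space A q" by (rule nabla_tangent[OF W(1) k_smooth frame_smooth q])
  have "D q (k q) (curvature (F 2) (F 3) (F 3)) = D q (k q) (\<lambda>q f. sectional q * F 2 q f)"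
    by (rule local[OF W(1) q curvature_smooth[OF W(1) frame_smooth frame_smooth frame_smooth]
          smooth_vfield_scale[OF sectional_smooth frame_smooth] _ kq]) (rule curvature_233)
  also have "\<dots> = (\<lambda>f. k q sectional * F 2 q f + sectional q * ?m f)"
    by (rule leibniz[OF W(1) q sectional_smooth frame_smooth kq])
  finally have dk: "D q (k q) (curvature (F 2) (F 3) (F 3)) = \<dots>" .
  have "g q ?n (F 3 q) = 0"
    using metric_D_frame[OF q k_smooth] by (simp add: nabla_def)
  then have "curvature (F 2) (F 3) (nabla D k (F 3)) q f = - sectional q * g q ?n (F 2 q) * F 3 q f" for f
    by (simp add: curvature_23[OF q nabla_smooth[OF W(1) k_smooth frame_smooth]])
  then have "(k q sectional + ?d * sectional q) * F 2 q f
      + (sectional q * ?m f + (sectional q * g q ?n (F 2 q)) * F 3 q f) = 0" for f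
    using bianchi_k[OF q frame_smooth, of 3 f] by (simp add: dk curvature_233[OF q] algebra_simps)
  then have "g q (\<lambda>f. (k q sectional + ?d * sectional q) * F 2 q f
      + (sectional q * ?m f + (sectional q * g q ?n (F 2 q)) * F 3 q f)) (F 2 q) = 0"
    using metric_zero_left[OF frame_tangent[OF q]] by simp
  then have "k q sectional + ?d * sectional q = 0"
    using metric_D_frame[OF q k_smooth, of 2] frame_metric[OF q, of 2 2] frame_metric[OF q, of 3 2]
    by (simp add: metric_add_left metric_scale_left tangent_scale tangent_add frame_tangent[OF q] T)
  then show ?thesis by linarith
qed

text \<open>Insert \<open>k\<close> into the Bianchi identity: since \<open>R(\<cdot>, \<cdot>) k = 0\<close>, only
  \<open>R(F\<^sub>2, F\<^sub>3) \<nabla>\<^sub>k k\<close> is left. Where the sectional curvature is not zero,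
  \<open>R(F\<^sub>2, F\<^sub>3)\<close> is injective on the plane of \<open>F\<^sub>2\<close> and \<open>F\<^sub>3\<close>, in which
  \<open>\<nabla>\<^sub>k k\<close> lies because \<open>k\<close> is a unit field.\<close>

lemma geodesic_field:
  assumes q: "q \<in> W" and nz: "sectional q \<noteq> 0"
  shows "D q (k q) k = (\<lambda>f. 0)"
proof -
  let ?n = "D q (k q) k"
  note kq = vfield_tangent[OF k_smooth q]
  have T: "?n \<in> tangent_space A q" by (rule nabla_tangent[OF W(1) k_smooth k_smooth q])
  have "D q (k q) (curvature (F 2) (F 3) k) = (\<lambda>f. 0)"
    by (rule D_zero[OF W(1) q curvature_smooth[OF W(1) frame_smooth frame_smooth k_smooth] kq]) (rule curvature_k_3[OF frame_smooth frame_smooth])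
  then have "curvature (F 2) (F 3) (nabla D k k) q f = 0" for f
    using bianchi_k[OF q k_smooth, of f] by (simp add: curvature_k_3[OF frame_smooth frame_smooth q])
  then have "g q ?n (F 3 q) * F 2 q f + (- g q ?n (F 2 q)) * F 3 q f = 0" for f
    using nz unfolding curvature_23[OF q nabla_smooth[OF W(1) k_smooth k_smooth]] by (simp add: nabla_def)
  then have z: "g q (\<lambda>f. g q ?n (F 3 q) * F 2 q f + (- g q ?n (F 2 q)) * F 3 q f) (F i q) = 0" for i
    using metric_zero_left[OF frame_tangent[OF q]] by simp
  have "g q ?n (F 3 q) = 0" "g q ?n (F 2 q) = 0"
    using z[of 2] z[of 3] unfolding metric_linear[OF frame_tangent[OF q] frame_tangent[OF q] frame_tangent[OF q]] frame_metric[OF q]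
    by simp_all
  moreover have "g q ?n (k q) = 0"
    using metric_D_frame[OF q k_smooth, of 1] by (simp add: F1)
  ultimately show ?thesis
    using frame_expand[OF q T] by (intro ext) simp
qed

lemma derivative_scalar_curvature:
  assumes q: "q \<in> W"
  shows "k q (scalar_curvature A g D) = - divergence A g D k q * scalar_curvature A g D q"
proof -
  note kq = vfield_tangent[OF k_smooth q]
  have "k q (scalar_curvature A g D) = k q (\<lambda>q. 2 * sectional q)"
    by (rule tangent_cong[OF kq W(1) q]) (rule scalar_curvature_eq)
  also have "\<dots> = 2 * k q sectional"
    by (rule tangent_of_scale[OF kq smooth_nearI[OF W(1) q sectional_smooth]])
  finally show ?thesis
    using derivative_sectional[OF q] by (simp add: scalar_curvature_eq[OF q])
qed

end

lemma scalar_curvature_smooth_near: "p \<in> U \<Longrightarrow> smooth_near A p (scalar_curvature A g D)"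
  and divergence_smooth_near: "p \<in> U \<Longrightarrow> smooth_near A p (divergence A g D k)"
  and k_scalar_curvature:
    "p \<in> U \<Longrightarrow> k p (scalar_curvature A g D) = - divergence A g D k p * scalar_curvature A g D p"
  and geodesic_at: "p \<in> U \<Longrightarrow> scalar_curvature A g D p \<noteq> 0 \<Longrightarrow> D p (k p) k = (\<lambda>f. 0)"
proof -
  assume "p \<in> U"
  then obtain W F where p: "p \<in> W"
    and WF: "open W" "W \<subseteq> U" "orthonormal_frame A g W F" "F 1 = k" by (rule adapted_frame_near)
  show "smooth_near A p (scalar_curvature A g D)" "smooth_near A p (divergence A g D k)"
    using smooth_nearI[OF WF(1) p] scalar_curvature_smooth[OF WF] divergence_smooth[OF WF] by auto
  show "k p (scalar_curvature A g D) = - divergence A g D k p * scalar_curvature A g D p"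
    by (rule derivative_scalar_curvature[OF WF p])
  show "D p (k p) k = (\<lambda>f. 0)" if "scalar_curvature A g D p \<noteq> 0"
    using geodesic_field[OF WF p] scalar_curvature_eq[OF WF p] that by simp
qed

text \<open>Along an integral curve of \<open>k\<close>, the scalar curvature solves \<open>s' = - (div k) s\<close>. So it is
  nonzero on the whole curve once it is nonzero at one point, and \<open>\<nabla>\<^sub>k k = 0\<close> at all points
  of the curve. In a frame that contains \<open>k\<close>, the velocity has constant coefficients, and its
  covariant derivative along the curve is \<open>\<nabla>\<^sub>k k\<close>.\<close>

lemma integral_curve_geodesic:
  assumes \<gamma>: "integral_curve A U k I \<gamma>" and t0: "t0 \<in> I"
    and nz: "scalar_curvature A g D (\<gamma> t0) \<noteq> 0"
  shows "geodesic A D I \<gamma>"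
proof -
  have I: "open I" "is_interval I" and sm: "smooth_curve A I \<gamma>"
    and U: "\<And>t. t \<in> I \<Longrightarrow> \<gamma> t \<in> U" and vel: "\<And>t. t \<in> I \<Longrightarrow> velocity A \<gamma> t = k (\<gamma> t)"
    using \<gamma> unfolding integral_curve_def by auto
  let ?s = "scalar_curvature A g D \<circ> \<gamma>" and ?d = "divergence A g D k \<circ> \<gamma>"
  have s: "(?s has_real_derivative - ?d t * ?s t) (at t)" if t: "t \<in> I" for t
    using velocity_has_derivative[OF sm I(1) t scalar_curvature_smooth_near[OF U[OF t]]]
      k_scalar_curvature[OF U[OF t]] vel[OF t] by simp
  have "\<forall>t\<in>I. isCont ?d t"
  proof
    fix t assume t: "t \<in> I"
    show "isCont ?d t"
      by (rule DERIV_isCont[OF velocity_has_derivative[OF sm I(1) t divergence_smooth_near[OF U[OF t]]]])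
  qed
  then have d: "continuous_on I ?d"
    by (rule continuous_at_imp_continuous_on)
  have eq: "?s a \<noteq> 0 \<longleftrightarrow> ?s b \<noteq> 0" if ab: "a \<in> I" "b \<in> I" "a \<le> b" for a b
  proof -
    have sub: "{a..b} \<subseteq> I" using mem_is_interval_1_I[OF I(2) ab(1,2)] by auto
    have "t \<in> I" if "t \<in> {a..b}" for t using sub that by (rule subsetD)
    from linear_ode_nonzero[OF ab(3) s[OF this] continuous_on_subset[OF d sub]]
    show ?thesis .
  qed
  have nz': "scalar_curvature A g D (\<gamma> t) \<noteq> 0" if "t \<in> I" for t
    using eq[of t t0] eq[of t0 t] that t0 nz by (cases "t \<le> t0") auto
  have "has_covariant_derivative_along A D \<gamma> (velocity A \<gamma>) t (\<lambda>f. 0)" if t: "t \<in> I" for t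
  proof -
    obtain W F where W: "\<gamma> t \<in> W"
      and WF: "open W" "W \<subseteq> U" "orthonormal_frame A g W F" "F 1 = k"
      by (rule adapted_frame_near[OF U[OF t]])
    then have F: "open W" "local_frame A W F" "F 1 = k"
      unfolding orthonormal_frame_def by auto
    let ?a = "\<lambda>(i::3) (t::real). if i = 1 then 1 else (0::real)"
    have a: "\<forall>\<^sub>F s in nhds t. velocity A \<gamma> s = (\<lambda>f. \<Sum>i\<in>UNIV. ?a i s * F i (\<gamma> s) f)"
      using eventually_nhds_in_open[OF I(1) t]
      by (rule eventually_mono) (simp add: sum_3 F(3) vel)
    have a': "\<forall>i. (?a i has_real_derivative 0) (at t)" by simp
    have w: "(\<lambda>f. 0) = (\<lambda>f. \<Sum>i\<in>UNIV. 0 * F i (\<gamma> t) f + ?a i t * D (\<gamma> t) (velocity A \<gamma> t) (F i) f)"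
      by (simp add: sum_3 F(3) vel[OF t] geodesic_at[OF U[OF t] nz'[OF t]])
    show ?thesis
      unfolding has_covariant_derivative_along_def
      by (rule exI[of _ W], rule exI[of _ F], rule exI[of _ ?a], rule exI[of _ "\<lambda>i. 0"])
         (intro conjI F(1,2) W a a' w)
  qed
  then show ?thesis
    using I sm unfolding geodesic_def by blast
qed

end

theorem proposition2:
  fixes A :: "('a::{t2_space, second_countable_topology}, 3) chart set"
    and g :: "'a \<Rightarrow> 'a tangent \<Rightarrow> 'a tangent \<Rightarrow> real"
    and D :: "'a \<Rightarrow> 'a tangent \<Rightarrow> 'a vfield \<Rightarrow> 'a tangent"
    and U :: "'a set" and k :: "'a vfield"
  assumes "levi_civita_connection A g D"
    and "open U"
    and "unit_vfield A g U k"
    and "two_principal A g D U k"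
  shows "(\<forall>p\<in>U. k p (scalar_curvature A g D) =
                 - divergence A g D k p * scalar_curvature A g D p) \<and>
         (\<forall>p\<in>U. scalar_curvature A g D p \<noteq> 0 \<longrightarrow>
            (\<forall>I \<gamma> t. integral_curve A U k I \<gamma> \<and> t \<in> I \<and> \<gamma> t = p \<longrightarrow> geodesic A D I \<gamma>))"
proof -
  interpret levi_civita_connection A g D by (rule assms(1))
  interpret two_principal_field A g D U k by unfold_locales (rule assms(2-4))+
  show ?thesis
  proof (intro conjI ballI impI allI)
    show "k p (scalar_curvature A g D) = - divergence A g D k p * scalar_curvature A g D p"
      if "p \<in> U" for p
      by (rule k_scalar_curvature[OF that])
    show "geodesic A D I \<gamma>"
      if "scalar_curvature A g D p \<noteq> 0" "integral_curve A U k I \<gamma> \<and> t \<in> I \<and> \<gamma> t = p" for p I \<gamma> t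
      using that integral_curve_geodesic[of I \<gamma> t] by simp
  qed
qed

end
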